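(* There exists a unique minimizer of $\mathcal F$ over $X_\varphi$.
   Context: $\Omega\subset\mathbb R^N$ is a bounded Lipschitz domain with Lebesgue measure, and $f\in L^2(\Omega)$. Standing assumptions on $\varphi:\Omega\times[0,\infty)\to[0,\infty)$: $x\mapsto\varphi(x,t)$ is measurable for every $t\ge0$; for a.e. $x\in\Omega$ the map $t\mapsto\varphi(x,t)$ is convex, increasing (in the non-strict sense), continuous, and $\varphi(x,0)=0$; $\varphi(\cdot,t)\in L^1(\Omega)$ for every $t\ge0$; there is a constant $C_\Delta$ with $\varphi(x,2t)\le C_\Delta\varphi(x,t)$ for a.e. $x\in\Omega$ and all $t\ge0$; and $\lim_{t\to\infty}\operatorname{ess\,inf}_{x\in\Omega}\varphi(x,t)/t=\infty$. For measurable $v:\Omega\to\mathbb R^N$ set $\rho_\varphi(v):=\int_\Omega\varphi(x,|v(x)|)\,dx$. Define $X_\varphi:=\{u\in L^2(\Omega)\cap W^{1,1}(\Omega): \rho_\varphi(\nabla u)<\infty\}$, where $\nabla u$ is the weak gradient, and $\mathcal F:X_\varphi\to\mathbb R$, $\mathcal F(u):=\frac12\|u-f\|_{L^2(\Omega)}^2+\rho_\varphi(\nabla u)$. *)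

theory Defs
  imports "HOL-Probability.Essential_Supremum"
begin

text \<open>
  The sets \<open>L2_fun\<close>, \<open>W11_fun\<close> and \<open>X_space\<close> below consist of representatives, not of
  equivalence classes: functions are defined on the whole space, only their values on \<open>\<Omega>\<close> matter,
  and equality in the function spaces means equality almost everywhere on \<open>\<Omega>\<close>.
\<close>

text \<open>
  Near each boundary point, \<open>\<Omega>\<close> is the strict epigraph of a Lipschitz function over the hyperplane
  orthogonal to a unit vector \<open>e\<close>; the argument of \<open>\<gamma>\<close> is the orthogonal projection of \<open>y\<close>
  onto that hyperplane.
\<close>

definition bounded_lipschitz_domain :: "'a::euclidean_space set \<Rightarrow> bool" where
  "bounded_lipschitz_domain \<Omega> \<longleftrightarrow>
     open \<Omega> \<and> connected \<Omega> \<and> \<Omega> \<noteq> {} \<and> bounded \<Omega> \<and>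
     (\<forall>p \<in> frontier \<Omega>. \<exists>r > 0. \<exists>e \<gamma> L. norm e = 1 \<and> L-lipschitz_on {z. z \<bullet> e = 0} \<gamma> \<and>
        \<Omega> \<inter> ball p r = {y \<in> ball p r. \<gamma> (y - (y \<bullet> e) *\<^sub>R e) < y \<bullet> e})"

primrec Ck :: "nat \<Rightarrow> ('a::euclidean_space \<Rightarrow> real) \<Rightarrow> bool" where
  "Ck 0 \<psi> \<longleftrightarrow> continuous_on UNIV \<psi>"
| "Ck (Suc k) \<psi> \<longleftrightarrow> \<psi> differentiable_on UNIV \<and>
     (\<forall>i \<in> Basis. Ck k (\<lambda>x. frechet_derivative \<psi> (at x) i))"

definition test_function :: "'a::euclidean_space set \<Rightarrow> ('a \<Rightarrow> real) \<Rightarrow> bool" where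
  "test_function \<Omega> \<psi> \<longleftrightarrow>
     (\<forall>k. Ck k \<psi>) \<and> compact (closure {x. \<psi> x \<noteq> 0}) \<and> closure {x. \<psi> x \<noteq> 0} \<subseteq> \<Omega>"

definition locally_integrable ::
    "'a::euclidean_space set \<Rightarrow> ('a \<Rightarrow> 'b::euclidean_space) \<Rightarrow> bool" where
  "locally_integrable \<Omega> g \<longleftrightarrow> (\<forall>K. compact K \<and> K \<subseteq> \<Omega> \<longrightarrow> integrable (lebesgue_on K) g)"

definition is_weak_gradient ::
    "'a::euclidean_space set \<Rightarrow> ('a \<Rightarrow> real) \<Rightarrow> ('a \<Rightarrow> 'a) \<Rightarrow> bool" where
  "is_weak_gradient \<Omega> u G \<longleftrightarrow>
     locally_integrable \<Omega> u \<and> locally_integrable \<Omega> G \<and>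
     (\<forall>\<psi>. test_function \<Omega> \<psi> \<longrightarrow> (\<forall>i \<in> Basis.
        (LINT x|lebesgue_on \<Omega>. u x * frechet_derivative \<psi> (at x) i) =
        - (LINT x|lebesgue_on \<Omega>. (G x \<bullet> i) * \<psi> x)))"

text \<open>
  A weak gradient is determined only up to a null set, so a representative is chosen; the choice
  depends on \<open>u\<close> only through its values almost everywhere on \<open>\<Omega>\<close>.
\<close>

definition weak_gradient ::
    "'a::euclidean_space set \<Rightarrow> ('a \<Rightarrow> real) \<Rightarrow> 'a \<Rightarrow> 'a" where
  "weak_gradient \<Omega> u = (SOME G. is_weak_gradient \<Omega> u G)"

definition L2_fun :: "'a::euclidean_space set \<Rightarrow> ('a \<Rightarrow> real) set" where
  "L2_fun \<Omega> = {u. u \<in> borel_measurable (lebesgue_on \<Omega>) \<and>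
                   integrable (lebesgue_on \<Omega>) (\<lambda>x. (u x)\<^sup>2)}"

definition L2_norm :: "'a::euclidean_space set \<Rightarrow> ('a \<Rightarrow> real) \<Rightarrow> real" where
  "L2_norm \<Omega> u = sqrt (LINT x|lebesgue_on \<Omega>. (u x)\<^sup>2)"

definition W11_fun :: "'a::euclidean_space set \<Rightarrow> ('a \<Rightarrow> real) set" where
  "W11_fun \<Omega> = {u. integrable (lebesgue_on \<Omega>) u \<and>
                   (\<exists>G. is_weak_gradient \<Omega> u G \<and> integrable (lebesgue_on \<Omega>) G)}"

definition essinf :: "'a measure \<Rightarrow> ('a \<Rightarrow> ereal) \<Rightarrow> ereal" where
  "essinf M g = - esssup M (\<lambda>x. - g x)"

definition modular ::
    "'a::euclidean_space set \<Rightarrow> ('a \<Rightarrow> real \<Rightarrow> real) \<Rightarrow> ('a \<Rightarrow> 'a) \<Rightarrow> ennreal" where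
  "modular \<Omega> \<phi> v = (\<integral>\<^sup>+ x. ennreal (\<phi> x (norm (v x))) \<partial>lebesgue_on \<Omega>)"

definition X_space ::
    "'a::euclidean_space set \<Rightarrow> ('a \<Rightarrow> real \<Rightarrow> real) \<Rightarrow> ('a \<Rightarrow> real) set" where
  "X_space \<Omega> \<phi> = {u \<in> L2_fun \<Omega> \<inter> W11_fun \<Omega>. modular \<Omega> \<phi> (weak_gradient \<Omega> u) < \<infinity>}"

definition functional_F ::
    "'a::euclidean_space set \<Rightarrow> ('a \<Rightarrow> real \<Rightarrow> real) \<Rightarrow> ('a \<Rightarrow> real) \<Rightarrow> ('a \<Rightarrow> real) \<Rightarrow> real" where
  "functional_F \<Omega> \<phi> f u =
     1 / 2 * (L2_norm \<Omega> (\<lambda>x. u x - f x))\<^sup>2 + enn2real (modular \<Omega> \<phi> (weak_gradient \<Omega> u))"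

end

theory Submission
  imports Defs
begin

text \<open>
  No weak compactness is needed. The fidelity term makes the energy uniformly convex in \<open>u\<close>, so
  minimizing sequences are Cauchy in \<open>L\<^sup>2\<close> and minimizers are unique. To control the gradients as well,
  choose in each sublevel set \<open>{energy \<le> inf + 1/n}\<close> (which is midpoint convex) an almost minimizer
  \<open>u\<^sub>n\<close> of the area functional \<open>\<integral> sqrt (1 + |\<nabla>u|\<^sup>2)\<close>. The area of the midpoint of \<open>u\<^sub>n\<close> and \<open>u\<^sub>k\<close> is
  then almost the mean of the two areas; since the area integrand is uniformly convex on bounded
  sets and superlinearity of \<open>\<phi>\<close> makes the large gradients negligible, the gradients are Cauchy in
  \<open>L\<^sup>1\<close>. Fatou's lemma along an almost everywhere convergent subsequence gives a minimizer.
\<close>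

section \<open>Smooth bump functions\<close>

text \<open>The obstacle is that \<open>\<phi>\<close> need not be strictly convex: a midpoint may
  have exactly the mean energy although the gradients differ, so the energy alone does not force the
  gradients of a minimizing sequence to converge in norm. The area breaks the tie. It is strictly
  convex, and its linear growth keeps it finite for every integrable gradient and bounded by a
  constant plus the energy. It is minimized inside energy sublevel sets, so the infimum of the
  energy is left untouched. The infima of the area over these shrinking sets increase to a finite
  limit; this makes the convexity gap of the area small. The analysis treats pairs of a function and
  a vector field; being a weak gradient enters only as a condition stable under midpoints and L1
  limits. The bump functions serve another purpose: \<open>weak_gradient\<close> is an arbitrary
  choice, and independence of the modular from it rests on uniqueness almost everywhere, which takes
  enough test functions.\<close>

definition flat_exp :: "real \<Rightarrow> nat \<Rightarrow> real \<Rightarrow> real" where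
  "flat_exp c k t = (if t > 0 then (1 / t) ^ k * exp (- c / t) else 0)"

text \<open>Substituting \<open>s = 1 / t\<close> turns the right-hand limit into the decay of
  \<open>s ^ k * exp (- c * s)\<close> at infinity.\<close>

lemma flat_exp_at_0:
  assumes "c > 0"
  shows "(flat_exp c k \<longlongrightarrow> 0) (at 0)"
proof -
  have "((\<lambda>s. (1/c)^k * ((c * s) ^ k / exp (c * s))) \<longlongrightarrow> (1/c)^k * 0) at_top"
    by (intro tendsto_mult_left filterlim_compose[OF tendsto_power_div_exp_0]
          filterlim_tendsto_pos_mult_at_top[OF tendsto_const assms filterlim_ident])
  then have "((\<lambda>s. s ^ k * exp (- c * s)) \<longlongrightarrow> 0) at_top"
    using assms by (simp add: power_mult_distrib field_simps exp_minus)
  from filterlim_compose[OF this filterlim_inverse_at_top_right]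
  have r: "((\<lambda>t. (1 / t) ^ k * exp (- c / t)) \<longlongrightarrow> 0) (at_right 0)"
    by (simp add: field_simps)
  have "(flat_exp c k \<longlongrightarrow> 0) (at_right 0)"
    by (rule Lim_transform_eventually[OF r])
      (auto simp: eventually_at_right_field flat_exp_def intro!: exI[of _ 1])
  moreover have "(flat_exp c k \<longlongrightarrow> 0) (at_left 0)"
    by (rule Lim_transform_eventually[OF tendsto_const])
      (auto simp: eventually_at_left_field flat_exp_def intro!: exI[of _ "-1"])
  ultimately show ?thesis
    by (simp add: filterlim_split_at)
qed

text \<open>The factor \<open>(1 / t) ^ k\<close> makes the family stable under differentiation up
  to linear combinations. The case \<open>k = 0\<close> is the classical smooth function that
  vanishes to all orders at the origin.\<close>

lemma flat_exp_deriv: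
  assumes "c > 0"
  shows "(flat_exp c k has_real_derivative
            c * flat_exp c (k + 2) t - real k * flat_exp c (k + 1) t) (at t)"
proof -
  consider "t > 0" | "t < 0" | "t = 0" by linarith
  then show ?thesis
  proof cases
    case 1
    have "((\<lambda>t. 1 / t) has_real_derivative - ((1 / t)\<^sup>2)) (at t)"
      using 1 by (auto intro!: derivative_eq_intros simp: field_simps power2_eq_square)
    from DERIV_power[OF this, of k]
    have p: "((\<lambda>t. (1 / t) ^ k) has_real_derivative - (real k * (1 / t) ^ (k + 1))) (at t)"
      by (cases k) (simp_all add: power2_eq_square algebra_simps)
    have "((\<lambda>t. exp (- c / t)) has_real_derivative exp (- c / t) * (c * (1 / t)\<^sup>2)) (at t)"
      using 1 by (auto intro!: derivative_eq_intros simp: field_simps power2_eq_square)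
    from DERIV_mult[OF p this]
    have "((\<lambda>t. (1 / t) ^ k * exp (- c / t)) has_real_derivative
            c * ((1 / t) ^ (k + 2) * exp (- c / t)) - real k * ((1 / t) ^ (k + 1) * exp (- c / t))) (at t)"
      by (simp add: power_add power2_eq_square algebra_simps)
    then show ?thesis
      using 1 by (subst has_field_derivative_cong_eventually[where g="\<lambda>t. (1 / t) ^ k * exp (- c / t)"])
        (auto simp: flat_exp_def eventually_at dist_real_def intro!: exI[of _ t])
  next
    case 2
    then show ?thesis
      by (subst has_field_derivative_cong_eventually[where g="\<lambda>t. 0"])
        (auto simp: flat_exp_def eventually_at dist_real_def intro!: exI[of _ "- t"])
  next
    case 3
    \<comment> \<open>Dividing by \<open>y\<close> only raises the exponent, so the limit at the
      origin is that of \<open>flat_exp_at_0\<close>.\<close>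
    have "(flat_exp c k y - flat_exp c k 0) / (y - 0) = flat_exp c (k+1) y" for y
      by (auto simp: flat_exp_def)
    then show ?thesis
      unfolding has_field_derivative_iff 3
      using flat_exp_at_0[OF assms, of "k+1"] by (simp add: flat_exp_def[of _ _ 0])
  qed
qed

text \<open>
  An algebra of functions closed under partial derivatives, so that a single induction shows that its
  elements are of class \<open>Ck k\<close> for every \<open>k\<close>.
\<close>

inductive_set bump_algebra :: "('a::euclidean_space \<Rightarrow> real) set" where
  base: "c > 0 \<Longrightarrow> (\<lambda>x. flat_exp c k (x \<bullet> v + s)) \<in> bump_algebra"
| const: "(\<lambda>x. r) \<in> bump_algebra"
| add: "f \<in> bump_algebra \<Longrightarrow> g \<in> bump_algebra \<Longrightarrow> (\<lambda>x. f x + g x) \<in> bump_algebra"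
| mult: "f \<in> bump_algebra \<Longrightarrow> g \<in> bump_algebra \<Longrightarrow> (\<lambda>x. f x * g x) \<in> bump_algebra"

lemma bump_algebra_prod:
  assumes "finite I" "\<And>i. i \<in> I \<Longrightarrow> f i \<in> bump_algebra"
  shows "(\<lambda>x. \<Prod>i\<in>I. f i x) \<in> bump_algebra"
  using assms by (induction I rule: finite_induct) (auto intro: bump_algebra.intros)

lemma bump_algebra_deriv:
  assumes "f \<in> bump_algebra"
  shows "\<exists>f'. \<forall>x. (f has_derivative f' x) (at x) \<and> (\<forall>i. (\<lambda>x. f' x i) \<in> bump_algebra)"
  using assms
proof induction
  case (base c k v s)
  let ?g = "\<lambda>x. c * flat_exp c (k+2) (x \<bullet> v + s) + (- real k) * flat_exp c (k+1) (x \<bullet> v + s)"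
  have "((\<lambda>x. flat_exp c k (x \<bullet> v + s)) has_derivative (\<lambda>h. ?g x * (h \<bullet> v))) (at x)" for x
  proof -
    have "((\<lambda>x. x \<bullet> v + s) has_derivative (\<lambda>h. h \<bullet> v)) (at x)"
      by (auto intro!: derivative_eq_intros)
    from has_derivative_compose[OF this
        flat_exp_deriv[OF base, THEN has_field_derivative_imp_has_derivative]]
    show ?thesis by (simp add: mult.commute algebra_simps)
  qed
  moreover have "(\<lambda>x. ?g x * (i \<bullet> v)) \<in> bump_algebra" for i
    by (intro bump_algebra.intros base)
  ultimately show ?case
    by (intro exI[of _ "\<lambda>x h. ?g x * (h \<bullet> v)"]) blast
next
  case (const r)
  show ?case by (intro exI[of _ "\<lambda>x h. 0"]) (auto intro: bump_algebra.intros)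
next
  case (add f g)
  then obtain f' g' where
    "\<And>x. (f has_derivative f' x) (at x)" "\<And>i. (\<lambda>x. f' x i) \<in> bump_algebra"
    "\<And>x. (g has_derivative g' x) (at x)" "\<And>i. (\<lambda>x. g' x i) \<in> bump_algebra" by metis
  then show ?case
    by (intro exI[of _ "\<lambda>x h. f' x h + g' x h"]) (auto intro!: has_derivative_add bump_algebra.intros)
next
  case (mult f g)
  then obtain f' g' where
    "\<And>x. (f has_derivative f' x) (at x)" "\<And>i. (\<lambda>x. f' x i) \<in> bump_algebra"
    "\<And>x. (g has_derivative g' x) (at x)" "\<And>i. (\<lambda>x. g' x i) \<in> bump_algebra" by metis
  with mult show ?case
    by (intro exI[of _ "\<lambda>x h. f x * g' x h + f' x h * g x"])
      (auto intro!: has_derivative_mult bump_algebra.intros)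
qed

lemma bump_algebra_Ck: "f \<in> bump_algebra \<Longrightarrow> Ck k f"
proof (induction k arbitrary: f)
  case 0
  then show ?case
    using bump_algebra_deriv[OF 0] by (metis Ck.simps(1) has_derivative_continuous_on has_derivative_at_withinI)
next
  case (Suc k)
  obtain f' where f': "\<And>x. (f has_derivative f' x) (at x)" "\<And>i. (\<lambda>x. f' x i) \<in> bump_algebra"
    using bump_algebra_deriv[OF Suc.prems] by metis
  have "frechet_derivative f (at x) = f' x" for x
    using frechet_derivative_at[OF f'(1)] by simp
  with f' Suc.IH show ?case
    by (auto simp: differentiable_on_def differentiable_def intro: has_derivative_at_withinI)
qed

text \<open>The parameter \<open>1 / real (Suc m)\<close> tends to 0, so every factor tends to 1
  where it is positive, while the set where the product is nonzero is the same open box for all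
  \<open>m\<close>.\<close>

definition box_bump :: "'a::euclidean_space \<Rightarrow> 'a \<Rightarrow> nat \<Rightarrow> 'a \<Rightarrow> real" where
  "box_bump a b m x = (\<Prod>i\<in>Basis. flat_exp (1 / real (Suc m)) 0 (x \<bullet> i - a \<bullet> i) *
     flat_exp (1 / real (Suc m)) 0 (b \<bullet> i - x \<bullet> i))"

lemma box_bump_eq_0_iff: "box_bump a b m x = 0 \<longleftrightarrow> x \<notin> box a b"
  by (auto simp: box_bump_def flat_exp_def mem_box)

lemma box_bump_bounds: "0 \<le> box_bump a b m x" "box_bump a b m x \<le> 1"
  unfolding box_bump_def
  by (auto intro!: prod_nonneg prod_le_1 mult_nonneg_nonneg mult_le_one simp: flat_exp_def)

lemma box_bump_tendsto: "(\<lambda>m. box_bump a b m x) \<longlonglongrightarrow> indicator (box a b) x"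
proof (cases "x \<in> box a b")
  case True
  have *: "(\<lambda>m. flat_exp (1 / real (Suc m)) 0 t) \<longlonglongrightarrow> 1" if "t > 0" for t
  proof -
    have "(\<lambda>m. exp (- ((1 / real (Suc m)) / t))) \<longlonglongrightarrow> exp (- (0 / t))"
      by (intro tendsto_intros LIMSEQ_Suc[OF lim_1_over_n]) (use that in auto)
    then show ?thesis using that by (simp add: flat_exp_def)
  qed
  have "(\<lambda>m. box_bump a b m x) \<longlonglongrightarrow> (\<Prod>i\<in>(Basis::'a set). 1 * 1)"
    unfolding box_bump_def
    by (intro tendsto_prod tendsto_mult *) (use True in \<open>auto simp: mem_box\<close>)
  with True show ?thesis by simp
next
  case False
  then show ?thesis by (simp add: iffD2[OF box_bump_eq_0_iff])
qed

lemma test_function_box_bump: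
  assumes "cbox a b \<subseteq> \<Omega>"
  shows "test_function \<Omega> (box_bump a b m)"
proof -
  have "box_bump a b m = (\<lambda>x. \<Prod>i\<in>Basis. flat_exp (1 / real (Suc m)) 0 (x \<bullet> i + (- (a \<bullet> i))) *
     flat_exp (1 / real (Suc m)) 0 (x \<bullet> (- i) + b \<bullet> i))"
    by (auto simp: box_bump_def)
  also have "\<dots> \<in> bump_algebra"
    by (intro bump_algebra_prod bump_algebra.intros) auto
  finally have "box_bump a b m \<in> bump_algebra" .
  moreover have "closure {x. box_bump a b m x \<noteq> 0} \<subseteq> cbox a b"
    by (simp add: box_bump_eq_0_iff box_subset_cbox closure_minimal closed_cbox)
  ultimately show ?thesis
    using assms compact_Int_closed[OF compact_cbox[of a b], of "closure {x. box_bump a b m x \<noteq> 0}"]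
    unfolding test_function_def by (auto intro: bump_algebra_Ck simp: Int_absorb1)
qed

section \<open>Uniqueness of weak gradients\<close>

lemma test_function_continuous: "test_function \<Omega> \<psi> \<Longrightarrow> continuous_on UNIV \<psi>"
  unfolding test_function_def by (metis Ck.simps(1))

lemma test_function_bounded:
  assumes "test_function \<Omega> \<psi>"
  obtains B where "B > 0" "\<And>x. norm (\<psi> x) \<le> B"
proof -
  let ?S = "closure {x. \<psi> x \<noteq> 0}"
  have "compact (\<psi> ` ?S)"
    using assms by (intro compact_continuous_image continuous_on_subset[OF test_function_continuous[OF assms]])
      (auto simp: test_function_def)
  then obtain B where B: "B > 0" "\<And>x. x \<in> ?S \<Longrightarrow> norm (\<psi> x) \<le> B"
    using compact_imp_bounded[of "\<psi> ` ?S"] by (auto simp: bounded_pos)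
  have "norm (\<psi> x) \<le> B" for x
    using B closure_subset[of "{x. \<psi> x \<noteq> 0}"] by (cases "\<psi> x = 0") auto
  with B that show ?thesis by blast
qed

lemma test_function_partial:
  assumes \<psi>: "test_function \<Omega> \<psi>" and i: "i \<in> Basis"
  shows "test_function \<Omega> (\<lambda>x. frechet_derivative \<psi> (at x) i)"
proof -
  let ?S = "closure {x. \<psi> x \<noteq> 0}"
  have "Ck (Suc k) \<psi>" for k
    using \<psi> unfolding test_function_def by blast
  then have Ck: "Ck k (\<lambda>x. frechet_derivative \<psi> (at x) i)" for k
    using i by simp
  have "frechet_derivative \<psi> (at x) i = 0" if x: "x \<notin> ?S" for x
  proof -
    have "(\<psi> has_derivative (\<lambda>h. 0)) (at x)"
      by (rule has_derivative_transform_within_open[of "\<lambda>x. 0" _ _ UNIV "- ?S"])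
        (use x closure_subset[of "{x. \<psi> x \<noteq> 0}"] in auto)
    then show ?thesis
      by (simp add: frechet_derivative_at[symmetric])
  qed
  then have "closure {x. frechet_derivative \<psi> (at x) i \<noteq> 0} \<subseteq> ?S"
    by (intro closure_minimal) auto
  then show ?thesis
    using Ck \<psi> compact_Int_closed[of ?S "closure {x. frechet_derivative \<psi> (at x) i \<noteq> 0}"]
    unfolding test_function_def by (auto simp: Int_absorb1)
qed

lemma test_function_measurable:
  assumes "test_function \<Omega> \<psi>" "S \<in> sets lebesgue"
  shows "\<psi> \<in> borel_measurable (lebesgue_on S)"
  using assms(2) by (intro continuous_imp_measurable_on_sets_lebesgue
      continuous_on_subset[OF test_function_continuous[OF assms(1)]]) auto

lemma integrable_times_bounded:
  fixes g \<psi> :: "'a \<Rightarrow> real"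
  assumes "integrable M g" "\<psi> \<in> borel_measurable M" "\<And>x. norm (\<psi> x) \<le> B"
  shows "integrable M (\<lambda>x. g x * \<psi> x)"
proof (rule Bochner_Integration.integrable_bound)
  show "integrable M (\<lambda>x. B * g x)" using assms by simp
  have "norm (g x * \<psi> x) \<le> norm (B * g x)" for x
    using assms(3)[of x] mult_right_mono[of "\<bar>\<psi> x\<bar>" "\<bar>B\<bar>" "\<bar>g x\<bar>"] by (simp add: abs_mult mult.commute)
  then show "AE x in M. norm (g x * \<psi> x) \<le> norm (B * g x)" by simp
qed (use assms in measurable)

text \<open>The support of \<open>\<psi>\<close> is a compact subset of \<open>\<Omega>\<close>,
  where \<open>g\<close> is integrable; outside it the product is 0, so nothing is gained or lost by
  integrating over all of \<open>\<Omega>\<close>.\<close>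

lemma integrable_times_test_function:
  assumes \<psi>: "test_function \<Omega> \<psi>" and g: "locally_integrable \<Omega> g" and \<Omega>: "\<Omega> \<in> sets lebesgue"
  shows "integrable (lebesgue_on \<Omega>) (\<lambda>x. g x * \<psi> x)"
proof -
  let ?S = "closure {x. \<psi> x \<noteq> 0}"
  have S: "compact ?S" "?S \<subseteq> \<Omega>" using \<psi> by (auto simp: test_function_def)
  obtain B where B: "\<And>x. norm (\<psi> x) \<le> B"
    using test_function_bounded[OF \<psi>] by blast
  have "integrable (lebesgue_on ?S) (\<lambda>x. g x * \<psi> x)"
    using g S by (intro integrable_times_bounded[OF _ _ B] test_function_measurable[OF \<psi>])
      (auto simp: locally_integrable_def)
  then have "integrable lebesgue (\<lambda>x. if x \<in> ?S then g x * \<psi> x else 0)"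
    by (subst Lebesgue_Measure.integrable_restrict_UNIV) auto
  moreover have "(if x \<in> ?S then g x * \<psi> x else 0) = (if x \<in> \<Omega> then g x * \<psi> x else 0)" for x
    using S(2) closure_subset[of "{x. \<psi> x \<noteq> 0}"] by auto
  ultimately show ?thesis
    using Lebesgue_Measure.integrable_restrict_UNIV[OF \<Omega>, of "\<lambda>x. g x * \<psi> x"] by simp
qed

text \<open>
  The bumps on a box increase to its indicator function, so \<open>g\<close> has integral zero over every box in
  \<open>\<Omega>\<close>, and by Lebesgue differentiation \<open>g\<close> vanishes almost everywhere.
\<close>

lemma integral_cbox_eq_0:
  fixes g :: "'a::euclidean_space \<Rightarrow> real"
  assumes g: "locally_integrable \<Omega> g" and \<Omega>: "\<Omega> \<in> sets lebesgue"
    and 0: "\<And>\<psi>. test_function \<Omega> \<psi> \<Longrightarrow> (LINT x|lebesgue_on \<Omega>. g x * \<psi> x) = 0"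
    and ab: "cbox a b \<subseteq> \<Omega>"
  shows "g integrable_on cbox a b" "integral (cbox a b) g = 0"
proof -
  let ?M = "lebesgue_on (cbox a b)"
  have int: "integrable ?M g"
    using g ab by (simp add: locally_integrable_def)
  then show "g integrable_on cbox a b"
    by (intro integrable_on_lebesgue_on) auto
  have meas: "box_bump a b m \<in> borel_measurable ?M" for m
    by (rule test_function_measurable[OF test_function_box_bump[OF order_refl]]) auto
  have [measurable]: "g \<in> borel_measurable ?M"
    using int by auto
  have lim: "(\<lambda>m. LINT x|?M. g x * box_bump a b m x) \<longlonglongrightarrow> (LINT x|?M. g x * indicator (box a b) x)"
  proof (rule integral_dominated_convergence)
    show "integrable ?M (\<lambda>x. norm (g x))" using int by simp
    show "(\<lambda>x. g x * indicator (box a b) x) \<in> borel_measurable ?M"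
      by (intro borel_measurable_times borel_measurable_indicator) (auto simp: sets_restrict_space_iff box_subset_cbox)
    show "AE x in ?M. (\<lambda>m. g x * box_bump a b m x) \<longlonglongrightarrow> g x * indicator (box a b) x"
      by (intro AE_I2 tendsto_mult_left box_bump_tendsto)
    show "AE x in ?M. norm (g x * box_bump a b m x) \<le> norm (g x)" for m
      by (intro AE_I2) (auto simp: abs_mult box_bump_bounds intro!: mult_left_le)
  qed (use meas in measurable)
  have "(LINT x|?M. g x * box_bump a b m x) = 0" for m
  proof -
    have "(LINT x|?M. g x * box_bump a b m x) =
       (LINT x|lebesgue. (if x \<in> cbox a b then g x * box_bump a b m x else 0))"
      by (subst Lebesgue_Measure.integral_restrict_UNIV) auto
    also have "\<dots> = (LINT x|lebesgue. (if x \<in> \<Omega> then g x * box_bump a b m x else 0))"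
      using ab box_subset_cbox[of a b]
      by (intro Bochner_Integration.integral_cong) (auto simp: box_bump_eq_0_iff)
    also have "\<dots> = (LINT x|lebesgue_on \<Omega>. g x * box_bump a b m x)"
      using \<Omega> by (subst Lebesgue_Measure.integral_restrict_UNIV) auto
    also have "\<dots> = 0"
      by (intro 0 test_function_box_bump ab)
    finally show ?thesis .
  qed
  with lim have "(LINT x|?M. g x * indicator (box a b) x) = 0"
    by (simp add: LIMSEQ_const_iff)
  moreover have "integrable ?M (\<lambda>x. g x * indicator (box a b) x)"
    using int by (intro integrable_real_mult_indicator) (auto simp: sets_restrict_space_iff box_subset_cbox)
  ultimately have "integral (cbox a b) (\<lambda>x. g x * indicator (box a b) x) = 0"
    by (subst lebesgue_integral_eq_integral[symmetric]) auto
  moreover have "integral (cbox a b) (\<lambda>x. g x * indicator (box a b) x) = integral (cbox a b) g"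
    by (rule integral_spike[OF negligible_frontier_interval[of a b]]) (auto simp: indicator_def)
  ultimately show "integral (cbox a b) g = 0" by simp
qed

lemma fundamental_lemma_calculus_of_variations:
  fixes g :: "'a::euclidean_space \<Rightarrow> real"
  assumes g: "locally_integrable \<Omega> g" and \<Omega>: "open \<Omega>"
    and 0: "\<And>\<psi>. test_function \<Omega> \<psi> \<Longrightarrow> (LINT x|lebesgue_on \<Omega>. g x * \<psi> x) = 0"
  shows "AE x in lebesgue_on \<Omega>. g x = 0"
proof -
  have \<Omega>_sets: "\<Omega> \<in> sets lebesgue" using \<Omega> by (simp add: borel_open)
  note cbox0 = integral_cbox_eq_0[OF g \<Omega>_sets 0]
  have box0: "AE x in lebesgue. x \<in> cbox a b \<longrightarrow> g x = 0" if ab: "cbox a b \<subseteq> \<Omega>" for a b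
  proof -
    \<comment> \<open>\<open>g\<close> is only locally integrable in \<open>\<Omega>\<close>,
      whereas the differentiation theorem below asks for integrability over every box. Cutting off
      at one box repairs this; intersections of boxes are boxes, so all integrals still
      vanish.\<close>
    define h where "h x = (if x \<in> cbox a b then g x else 0)" for x
    have h: "h integrable_on cbox c d \<and> integral (cbox c d) h = 0" for c d
    proof -
      obtain p q where pq: "cbox a b \<inter> cbox c d = cbox p q"
        by (simp only: Int_interval that)
      with ab have "cbox p q \<subseteq> \<Omega>" by blast
      then show ?thesis
        using cbox0[of p q] pq unfolding h_def
        by (simp add: integrable_restrict_Int[of _ g] Henstock_Kurzweil_Integration.integral_restrict_Int)
    qed
    obtain N where N: "negligible N" "\<And>x e. \<lbrakk>x \<notin> N; 0 < e\<rbrakk> \<Longrightarrow>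
        \<exists>d>0. \<forall>r. 0 < r \<and> r < d \<longrightarrow>
          norm (integral (cbox x (x + r *\<^sub>R One)) h /\<^sub>R r ^ DIM('a) - h x) < e"
      by (rule integrable_ccontinuous_explicit[of h, OF conjunct1[OF h]]) (rule that)
    have "h x = 0" if "x \<notin> N" for x
    proof (rule ccontr)
      assume "h x \<noteq> 0"
      \<comment> \<open>All averages of \<open>h\<close> are 0, so the tolerance
        \<open>norm (h x)\<close> would give \<open>norm (h x) < norm (h x)\<close> for every small
        \<open>r\<close>.\<close>
      with N(2)[OF that, of "norm (h x)"] have "\<exists>d>0::real. \<forall>r. 0 < r \<longrightarrow> \<not> r < d"
        by (simp add: h)
      then show False using dense by blast
    qed
    then have "{x. \<not> (x \<in> cbox a b \<longrightarrow> g x = 0)} \<subseteq> N"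
      unfolding h_def by (metis (mono_tags, lifting) mem_Collect_eq subsetI)
    then show ?thesis
      using N(1) by (auto simp: eventually_ae_filter negligible_iff_null_sets)
  qed
  obtain \<D> where \<D>: "countable \<D>" "\<D> \<subseteq> Pow \<Omega>" "\<And>X. X \<in> \<D> \<Longrightarrow> \<exists>a b. X = cbox a b" "\<Union>\<D> = \<Omega>"
    using open_countable_Union_open_cbox[OF \<Omega>] by blast
  have "AE x in lebesgue. \<forall>X\<in>\<D>. x \<in> X \<longrightarrow> g x = 0"
  proof (subst AE_ball_countable[OF \<D>(1)], intro ballI)
    fix X assume "X \<in> \<D>"
    with \<D> obtain a b where "X = cbox a b" "cbox a b \<subseteq> \<Omega>" by (metis Pow_iff subset_iff)
    with box0 show "AE x in lebesgue. x \<in> X \<longrightarrow> g x = 0" by blast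
  qed
  then show ?thesis
    using \<Omega>_sets \<D>(4) by (auto simp: AE_restrict_space_iff elim: eventually_mono)
qed

text \<open>Makes the arbitrary choice in \<open>weak_gradient\<close> harmless: the modular may be
  computed with any weak gradient. Each component of the difference has integral 0 against every
  test function.\<close>

lemma weak_gradient_unique:
  fixes u :: "'a::euclidean_space \<Rightarrow> real"
  assumes "open \<Omega>" and G: "is_weak_gradient \<Omega> u G" and H: "is_weak_gradient \<Omega> u H"
  shows "AE x in lebesgue_on \<Omega>. G x = H x"
proof -
  have "AE x in lebesgue_on \<Omega>. (G x - H x) \<bullet> i = 0" if i: "i \<in> Basis" for i
  proof (rule fundamental_lemma_calculus_of_variations[OF _ \<open>open \<Omega>\<close>])
    show "locally_integrable \<Omega> (\<lambda>x. (G x - H x) \<bullet> i)"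
      using G H by (auto simp: is_weak_gradient_def locally_integrable_def)
    fix \<psi> assume \<psi>: "test_function \<Omega> \<psi>"
    have "integrable (lebesgue_on \<Omega>) (\<lambda>x. (K x \<bullet> i) * \<psi> x)" if "locally_integrable \<Omega> K" for K :: "'a \<Rightarrow> 'a"
      using that \<open>open \<Omega>\<close>
      by (intro integrable_times_test_function[OF \<psi>]) (auto simp: locally_integrable_def borel_open)
    then show "(LINT x|lebesgue_on \<Omega>. (G x - H x) \<bullet> i * \<psi> x) = 0"
      using G H \<psi> i unfolding is_weak_gradient_def
      by (simp add: inner_diff_left left_diff_distrib Bochner_Integration.integral_diff)
  qed
  then have "AE x in lebesgue_on \<Omega>. \<forall>i\<in>Basis. (G x - H x) \<bullet> i = 0"
    by (subst AE_finite_all) auto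
  then show ?thesis
    by (rule eventually_mono) (auto simp: euclidean_eq_iff[of "G _"] inner_diff_left)
qed

section \<open>Convergence and measurability\<close>

text \<open>Both modes of convergence are used later: almost everywhere along a subsequence for
  lower semicontinuity, and in norm for the weak gradient identity. Norm convergence follows from
  Fatou's lemma applied to \<open>s n - s (r i)\<close> with \<open>n\<close> fixed.\<close>

lemma L1_cauchy_limit:
  fixes s :: "nat \<Rightarrow> 'a \<Rightarrow> 'b::{banach, second_countable_topology}"
  assumes int: "\<And>n. integrable M (s n)"
    and cauchy: "\<And>e. e > 0 \<Longrightarrow> \<exists>N. \<forall>i\<ge>N. \<forall>j\<ge>N. (LINT x|M. norm (s i x - s j x)) < e"
  obtains r g where "strict_mono r" "integrable M g" "AE x in M. (\<lambda>i. s (r i) x) \<longlonglongrightarrow> g x"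
    "(\<lambda>n. LINT x|M. norm (s n x - g x)) \<longlonglongrightarrow> 0"
proof -
  obtain r where r: "strict_mono r" "AE x in M. Cauchy (\<lambda>i. s (r i) x)"
    using cauchy_L1_AE_cauchy_subseq[of M s, OF int cauchy] by blast
  define g where "g x = lim (\<lambda>i. s (r i) x)" for x
  have [measurable]: "s n \<in> borel_measurable M" for n using int by auto
  have [measurable]: "g \<in> borel_measurable M"
    unfolding g_def by (intro borel_measurable_lim_metric) measurable
  have lim: "AE x in M. (\<lambda>i. s (r i) x) \<longlonglongrightarrow> g x"
    using r(2) by eventually_elim (simp add: g_def Cauchy_convergent_iff convergent_LIMSEQ_iff)
  have close: "\<exists>N. \<forall>n\<ge>N. (\<integral>\<^sup>+x. norm (s n x - g x) \<partial>M) \<le> ennreal e" if e: "e > 0" for e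
  proof -
    obtain N where N: "\<And>i j. \<lbrakk>i \<ge> N; j \<ge> N\<rbrakk> \<Longrightarrow> (LINT x|M. norm (s i x - s j x)) < e"
      using cauchy[OF e] by meson
    have "(\<integral>\<^sup>+x. norm (s n x - g x) \<partial>M) \<le> ennreal e" if n: "n \<ge> N" for n
    proof -
      have "(\<integral>\<^sup>+x. norm (s n x - g x) \<partial>M) = (\<integral>\<^sup>+x. liminf (\<lambda>i. ennreal (norm (s n x - s (r i) x))) \<partial>M)"
      proof (rule nn_integral_cong_AE, use lim in eventually_elim)
        case (elim x)
        have "(\<lambda>i. ennreal (norm (s n x - s (r i) x))) \<longlonglongrightarrow> ennreal (norm (s n x - g x))"
          by (intro tendsto_intros elim)
        then show ?case by (metis lim_imp_Liminf trivial_limit_sequentially)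
      qed
      also have "\<dots> \<le> liminf (\<lambda>i. \<integral>\<^sup>+x. norm (s n x - s (r i) x) \<partial>M)"
        by (intro nn_integral_liminf) measurable
      also have "\<dots> \<le> ennreal e"
      proof (rule order_trans[OF Liminf_mono Liminf_const[THEN eq_refl]])
        show "\<forall>\<^sub>F i in sequentially. (\<integral>\<^sup>+x. norm (s n x - s (r i) x) \<partial>M) \<le> ennreal e"
          using eventually_ge_at_top[of N]
        proof eventually_elim
          case (elim i)
          have "r i \<ge> N" using seq_suble[OF r(1), of i] elim by linarith
          then show ?case
            using N[OF n, of "r i"] int by (subst nn_integral_eq_integral) (auto intro!: ennreal_leI)
        qed
      qed simp
      finally show ?thesis .
    qed
    then show ?thesis by blast
  qed
  have int_diff: "\<exists>N. \<forall>n\<ge>N. integrable M (\<lambda>x. s n x - g x) \<and> (LINT x|M. norm (s n x - g x)) \<le> e"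
    if e: "e > 0" for e
  proof -
    obtain N where N: "\<And>n. n \<ge> N \<Longrightarrow> (\<integral>\<^sup>+x. norm (s n x - g x) \<partial>M) \<le> ennreal e"
      using close[OF e] by blast
    have "integrable M (\<lambda>x. s n x - g x)" if "n \<ge> N" for n
      unfolding integrable_iff_bounded using N[OF that] by (auto simp: less_top[symmetric] top_unique)
    moreover from this have "(LINT x|M. norm (s n x - g x)) \<le> e" if "n \<ge> N" for n
      using N[OF that] that \<open>e > 0\<close> by (subst (asm) nn_integral_eq_integral) auto
    ultimately show ?thesis by blast
  qed
  show ?thesis
  proof
    obtain n where "integrable M (\<lambda>x. s n x - g x)" using int_diff[of 1] by auto
    from Bochner_Integration.integrable_diff[OF int[of n] this] show "integrable M g" by simp
    show "(\<lambda>n. LINT x|M. norm (s n x - g x)) \<longlonglongrightarrow> 0"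
    proof (rule LIMSEQ_I)
      fix e :: real assume "e > 0"
      with int_diff[of "e / 2"] obtain N where "\<forall>n\<ge>N. (LINT x|M. norm (s n x - g x)) \<le> e / 2" by auto
      with \<open>e > 0\<close> show "\<exists>N. \<forall>n\<ge>N. norm ((LINT x|M. norm (s n x - g x)) - 0) < e"
        by (intro exI[of _ N]) fastforce
    qed
  qed (use r lim in auto)
qed

section \<open>Quantitative strict convexity of the area integrand\<close>

definition area_integrand :: "'b::real_inner \<Rightarrow> real" where
  "area_integrand z = sqrt (1 + (norm z)\<^sup>2)"

lemma area_integrand_bounds: "1 \<le> area_integrand z" "area_integrand z \<le> 1 + norm z"
  by (auto simp: area_integrand_def intro!: real_le_lsqrt simp: power2_sum)

lemma area_integrand_measurable [measurable]:
  "area_integrand \<in> borel_measurable borel"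
  unfolding area_integrand_def by measurable

text \<open>With \<open>A\<close>, \<open>B\<close> the values at \<open>a\<close>,
  \<open>b\<close>, with \<open>J\<close> the value at the midpoint and
  \<open>P = 1 + a \<bullet> b\<close>, two relations do the work:
  \<open>A\<^sup>2 * B\<^sup>2 - P\<^sup>2\<close> dominates \<open>(norm (a - b))\<^sup>2\<close>,
  and \<open>(A + B)\<^sup>2 - 4 * J\<^sup>2 = 2 * (A * B - P)\<close>. Both differences of squares
  are factored; the sums are at most \<open>2 * R\<^sup>2\<close> and \<open>4 * R\<close>, whence
  \<open>8 * R ^ 3\<close>.\<close>

lemma area_integrand_midpoint:
  fixes a b :: "'b::real_inner"
  assumes "area_integrand a \<le> R" "area_integrand b \<le> R"
  shows "(norm (a - b))\<^sup>2 \<le>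
    8 * R ^ 3 * ((area_integrand a + area_integrand b) / 2 - area_integrand ((1/2) *\<^sub>R (a + b)))"
proof -
  define A B J P where "A = area_integrand a" and "B = area_integrand b"
    and "J = area_integrand ((1/2) *\<^sub>R (a + b))" and "P = 1 + a \<bullet> b"
  have ge1: "1 \<le> A" "1 \<le> B" "1 \<le> J" and R: "A \<le> R" "B \<le> R"
    using assms area_integrand_bounds by (auto simp: A_def B_def J_def)
  have "4 * J\<^sup>2 = 4 + (norm (a + b))\<^sup>2"
    by (simp add: J_def area_integrand_def power_divide add_nonneg_nonneg)
  then have sq: "A\<^sup>2 = 1 + a \<bullet> a" "B\<^sup>2 = 1 + b \<bullet> b" "4 * J\<^sup>2 = 4 + (a \<bullet> a + 2 * (a \<bullet> b) + b \<bullet> b)"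
    by (simp_all add: A_def B_def area_integrand_def add_nonneg_nonneg
        power2_norm_eq_inner inner_add_left inner_add_right inner_commute[of b a])
  have "(a \<bullet> b)\<^sup>2 \<le> (a \<bullet> a) * (b \<bullet> b)"
    by (rule Cauchy_Schwarz_ineq)
  moreover have "(norm (a - b))\<^sup>2 = a \<bullet> a - 2 * (a \<bullet> b) + b \<bullet> b"
    by (simp add: dot_square_norm[symmetric] inner_diff_left inner_diff_right inner_commute[of b a])
  moreover have "(A * B - P) * (A * B + P) = A\<^sup>2 * B\<^sup>2 - P\<^sup>2"
    by (simp add: power2_eq_square algebra_simps)
  \<comment> \<open>Lagrange identity for the vectors \<open>(1, a)\<close> and \<open>(1, b)\<close>, whose norms are
      \<open>A\<close> and \<open>B\<close> and whose inner product is \<open>P\<close>.\<close>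
  ultimately have 1: "(norm (a - b))\<^sup>2 \<le> (A * B - P) * (A * B + P)"
    unfolding sq P_def by (simp add: power2_eq_square algebra_simps)
  have "P\<^sup>2 \<le> (A * B)\<^sup>2"
    using order_trans[OF zero_le_power2 1] by (simp add: power2_eq_square algebra_simps)
  then have P: "P \<le> A * B"
    by (rule power2_le_imp_le) (use ge1 in auto)
  have AB: "A * B \<le> R * R"
    using ge1 R by (intro mult_mono) auto
  have 2: "(norm (a - b))\<^sup>2 \<le> (A * B - P) * (2 * (R * R))"
    by (rule order_trans[OF 1]) (use P AB in \<open>auto intro!: mult_left_mono\<close>)
  have 3: "(A + B - 2 * J) * (A + B + 2 * J) = 2 * (A * B - P)"
    using sq by (simp add: power2_eq_square algebra_simps P_def)
  \<comment> \<open>Besides the sign this gives \<open>2 * J \<le> A + B \<le> 2 * R\<close>, hence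
    the bound \<open>4 * R\<close> on the sum below.\<close>
  have gap: "0 \<le> A + B - 2 * J"
  proof (rule ccontr)
    assume "\<not> ?thesis"
    then have "(A + B - 2 * J) * (A + B + 2 * J) < 0"
      using ge1 by (intro mult_neg_pos) auto
    with 3 P show False by simp
  qed
  then have "(A + B - 2 * J) * (A + B + 2 * J) \<le> (A + B - 2 * J) * (4 * R)"
    using R by (intro mult_left_mono) auto
  then have "2 * (A * B - P) * (R * R) \<le> (A + B - 2 * J) * (4 * R) * (R * R)"
    unfolding 3 by (rule mult_right_mono) simp
  then have "(A * B - P) * (2 * (R * R)) \<le> (A + B - 2 * J) * (4 * R) * (R * R)"
    by (simp only: ac_simps)
  also have "\<dots> = 8 * R ^ 3 * ((A + B) / 2 - J)"
    by (simp add: power3_eq_cube algebra_simps)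
  finally show ?thesis
    using 2 unfolding A_def B_def J_def by linarith
qed

lemma area_integrand_midpoint_convex:
  "area_integrand ((1/2) *\<^sub>R (a + b)) \<le> (area_integrand a + area_integrand b) / 2"
proof -
  define R where "R = max (area_integrand a) (area_integrand b)"
  have "R > 0" using area_integrand_bounds(1)[of a] by (simp add: R_def)
  have "0 \<le> 8 * R ^ 3 * ((area_integrand a + area_integrand b) / 2 - area_integrand ((1/2) *\<^sub>R (a + b)))"
    by (rule order_trans[OF zero_le_power2 area_integrand_midpoint]) (auto simp: R_def)
  with \<open>R > 0\<close> show ?thesis
    by (simp add: zero_le_mult_iff)
qed

text \<open>
  The three terms cover, in this order, small differences, differences with both norms at most \<open>T\<close>,
  and the case that one norm exceeds \<open>T\<close>.
\<close>

lemma norm_diff_le_area_gap: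
  fixes a b :: "'b::real_inner"
  assumes "\<epsilon> > 0" "\<eta> \<ge> 0" "T \<ge> 0"
    and nonneg: "\<And>t. t \<ge> 0 \<Longrightarrow> \<phi> t \<ge> 0"
    and superlinear: "\<And>t. t \<ge> T \<Longrightarrow> t \<le> \<eta> * \<phi> t"
  shows "norm (a - b) \<le> \<epsilon> + 8 * (1 + T) ^ 3 / \<epsilon> *
      ((area_integrand a + area_integrand b) / 2 - area_integrand ((1/2) *\<^sub>R (a + b)))
    + 2 * \<eta> * (\<phi> (norm a) + \<phi> (norm b))" (is "_ \<le> \<epsilon> + ?gap + ?tail")
proof -
  have nn: "?gap \<ge> 0" "\<eta> * \<phi> (norm a) \<ge> 0" "\<eta> * \<phi> (norm b) \<ge> 0"
    using assms area_integrand_midpoint_convex[of a b] by (auto intro!: mult_nonneg_nonneg)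
  have tri: "norm (a - b) \<le> norm a + norm b" by (rule norm_triangle_ineq4)
  show ?thesis
  proof (cases "norm a \<le> T \<and> norm b \<le> T")
    case True
    let ?d = "norm (a - b)"
    have "?d\<^sup>2 \<le> 8 * (1 + T) ^ 3 *
      ((area_integrand a + area_integrand b) / 2 - area_integrand ((1/2) *\<^sub>R (a + b)))"
      using True by (intro area_integrand_midpoint order_trans[OF area_integrand_bounds(2)]) auto
    then have "?d\<^sup>2 / \<epsilon> \<le> ?gap"
      using \<open>\<epsilon> > 0\<close> by (simp add: divide_simps mult.commute)
    moreover have "?d \<le> \<epsilon> + ?d\<^sup>2 / \<epsilon>"
    proof (cases "?d \<le> \<epsilon>")
      case False
      then have "?d * \<epsilon> \<le> ?d\<^sup>2" by (simp add: power2_eq_square mult_left_mono)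
      with \<open>\<epsilon> > 0\<close> show ?thesis by (simp add: field_simps add_increasing)
    qed (use \<open>\<epsilon> > 0\<close> in \<open>simp add: add_increasing2\<close>)
    ultimately show ?thesis using nn by (simp add: algebra_simps)
  next
    case False
    \<comment> \<open>The larger of the two norms exceeds \<open>T\<close>, and the sum is at most
      twice the larger one; hence the factor 2 in the last term.\<close>
    then have "norm a + norm b \<le> 2 * (\<eta> * \<phi> (norm a)) + 2 * (\<eta> * \<phi> (norm b))"
      using superlinear[of "norm a"] superlinear[of "norm b"] nn
      by (cases "norm a \<le> norm b") linarith+
    then have "norm a + norm b \<le> ?tail" by (simp add: algebra_simps)
    with tri nn \<open>\<epsilon> > 0\<close> show ?thesis by linarith
  qed
qed

section \<open>Measurability of limits and of superpositions\<close>

lemma borel_measurable_lebesgue_on_AE_LIMSEQ: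
  fixes f :: "nat \<Rightarrow> 'a::euclidean_space \<Rightarrow> real"
  assumes S: "S \<in> sets lebesgue" and meas: "\<And>n. f n \<in> borel_measurable (lebesgue_on S)"
    and lim: "AE x in lebesgue_on S. (\<lambda>n. f n x) \<longlonglongrightarrow> g x"
  shows "g \<in> borel_measurable (lebesgue_on S)"
proof -
  have "(\<lambda>x. lim (\<lambda>n. f n x)) \<in> borel_measurable (lebesgue_on S)"
    by (intro borel_measurable_lim_metric meas)
  \<comment> \<open>Extending by 0 moves the question to \<open>lebesgue\<close> on the whole space,
    whose completeness permits changes on a null set.\<close>
  then have "(\<lambda>x. if x \<in> S then lim (\<lambda>n. f n x) else 0) \<in> borel_measurable lebesgue"
    using S by (simp add: borel_measurable_if)
  moreover have "AE x in lebesgue. (if x \<in> S then lim (\<lambda>n. f n x) else 0) = (if x \<in> S then g x else 0)"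
    using lim S by (auto simp: AE_restrict_space_iff limI elim!: eventually_mono)
  ultimately have "(\<lambda>x. if x \<in> S then g x else 0) \<in> borel_measurable lebesgue"
    by (rule borel_measurable_AE)
  then show ?thesis using S by (simp add: borel_measurable_if)
qed

text \<open>Rounding \<open>h\<close> down to multiples of \<open>1 / real (Suc n)\<close> leaves
  countably many values, so the superposition is glued from the measurable functions
  \<open>\<lambda>x. \<phi> x t\<close> with \<open>t\<close> fixed; continuity in \<open>t\<close>
  handles the limit.\<close>

lemma caratheodory_measurable:
  fixes \<phi> :: "'a::euclidean_space \<Rightarrow> real \<Rightarrow> real"
  assumes S: "S \<in> sets lebesgue"
    and meas: "\<And>t. t \<ge> 0 \<Longrightarrow> (\<lambda>x. \<phi> x t) \<in> borel_measurable (lebesgue_on S)"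
    and cont: "AE x in lebesgue_on S. continuous_on {0..} (\<phi> x)"
    and h: "h \<in> borel_measurable (lebesgue_on S)" "\<And>x. h x \<ge> 0"
  shows "(\<lambda>x. \<phi> x (h x)) \<in> borel_measurable (lebesgue_on S)"
proof (rule borel_measurable_lebesgue_on_AE_LIMSEQ[OF S])
  define q where "q n x = real (nat \<lfloor>real (Suc n) * h x\<rfloor>) / real (Suc n)" for n x
  have q: "q n x \<ge> 0" "\<bar>q n x - h x\<bar> \<le> 1 / real (Suc n)" for n x
  proof -
    have "real (nat \<lfloor>real (Suc n) * h x\<rfloor>) = of_int \<lfloor>real (Suc n) * h x\<rfloor>"
      using h(2)[of x] by (simp add: zero_le_mult_iff)
    moreover have "\<bar>of_int \<lfloor>real (Suc n) * h x\<rfloor> - real (Suc n) * h x\<bar> \<le> 1"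
      by linarith
    ultimately have "\<bar>real (Suc n) * (q n x - h x)\<bar> \<le> 1"
      by (simp add: q_def right_diff_distrib)
    then have "real (Suc n) * \<bar>q n x - h x\<bar> \<le> 1"
      by (simp only: abs_mult abs_of_nat)
    then show "\<bar>q n x - h x\<bar> \<le> 1 / real (Suc n)"
      by (simp add: field_simps)
  qed (simp add: q_def)
  show "(\<lambda>x. \<phi> x (q n x)) \<in> borel_measurable (lebesgue_on S)" for n
    unfolding q_def
  proof (rule measurable_compose_countable[where f="\<lambda>k x. \<phi> x (real k / real (Suc n))"])
    show "(\<lambda>x. nat \<lfloor>real (Suc n) * h x\<rfloor>) \<in> measurable (lebesgue_on S) (count_space UNIV)"
      using h(1) by measurable
  qed (simp add: meas)
  show "AE x in lebesgue_on S. (\<lambda>n. \<phi> x (q n x)) \<longlonglongrightarrow> \<phi> x (h x)"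
    using cont
  proof eventually_elim
    case (elim x)
    have "(\<lambda>n. q n x - h x) \<longlonglongrightarrow> 0"
      by (rule Lim_null_comparison[OF _ LIMSEQ_Suc[OF lim_1_over_n]]) (use q in auto)
    then have "(\<lambda>n. q n x) \<longlonglongrightarrow> h x" by (simp add: LIM_zero_iff)
    then show ?case
      using elim q h by (intro continuous_on_tendsto_compose[OF elim]) auto
  qed
qed

section \<open>The energy and the area functional\<close>

lemma integrable_square_lincomb:
  fixes u v :: "'a \<Rightarrow> real"
  assumes [measurable]: "u \<in> borel_measurable M" "v \<in> borel_measurable M"
    and "integrable M (\<lambda>x. (u x)\<^sup>2)" "integrable M (\<lambda>x. (v x)\<^sup>2)"
  shows "integrable M (\<lambda>x. (a * u x + b * v x)\<^sup>2)"
proof (rule Bochner_Integration.integrable_bound)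
  show "integrable M (\<lambda>x. 2 * a\<^sup>2 * (u x)\<^sup>2 + 2 * b\<^sup>2 * (v x)\<^sup>2)"
    using assms by simp
  have "(a * u x + b * v x)\<^sup>2 \<le> 2 * a\<^sup>2 * (u x)\<^sup>2 + 2 * b\<^sup>2 * (v x)\<^sup>2" for x
    using zero_le_power2[of "a * u x - b * v x"] by (simp add: power2_eq_square algebra_simps)
  then show "AE x in M. norm ((a * u x + b * v x)\<^sup>2) \<le> norm (2 * a\<^sup>2 * (u x)\<^sup>2 + 2 * b\<^sup>2 * (v x)\<^sup>2)"
    by (intro AE_I2) (simp add: order_trans[OF _ abs_ge_self])
qed measurable

lemma (in finite_measure) integrable_of_square:
  fixes u :: "'a \<Rightarrow> real"
  assumes [measurable]: "u \<in> borel_measurable M" and "integrable M (\<lambda>x. (u x)\<^sup>2)"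
  shows "integrable M u"
proof (rule Bochner_Integration.integrable_bound)
  show "integrable M (\<lambda>x. 1 + (u x)\<^sup>2)" using assms by simp
  have "\<bar>u x\<bar> \<le> 1 + (u x)\<^sup>2" for x
    using zero_le_power2[of "\<bar>u x\<bar> - 1"] by (simp add: power2_eq_square algebra_simps)
  then show "AE x in M. norm (u x) \<le> norm (1 + (u x)\<^sup>2)"
    by (intro AE_I2) (simp add: order_trans[OF _ abs_ge_self])
qed measurable

text \<open>The vector field paired with a function \<open>u\<close> is independent of
  \<open>u\<close> in this setting, so a finite measure space is enough. Superlinear growth is
  stated with one threshold \<open>T\<close> valid almost everywhere, so that large values can be
  estimated under the integral.\<close>

locale superlinear_energy = finite_measure M for M :: "'a measure" +
  fixes \<phi> :: "'a \<Rightarrow> real \<Rightarrow> real" and f :: "'a \<Rightarrow> real"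
  assumes nonneg: "\<And>x t. x \<in> space M \<Longrightarrow> t \<ge> 0 \<Longrightarrow> 0 \<le> \<phi> x t"
    and caratheodory: "\<And>h. h \<in> borel_measurable M \<Longrightarrow> (\<And>x. h x \<ge> 0) \<Longrightarrow>
          (\<lambda>x. \<phi> x (h x)) \<in> borel_measurable M"
    and regular: "AE x in M. convex_on {0..} (\<phi> x) \<and> mono_on {0..} (\<phi> x) \<and> continuous_on {0..} (\<phi> x)"
    and superlinear: "\<And>\<eta>. \<eta> > 0 \<Longrightarrow> \<exists>T\<ge>0. AE x in M. \<forall>t\<ge>T. t \<le> \<eta> * \<phi> x t"
    and f_measurable [measurable]: "f \<in> borel_measurable M"
    and f_square: "integrable M (\<lambda>x. (f x)\<^sup>2)"
begin

definition finite_energy :: "('a \<Rightarrow> real) \<Rightarrow> ('a \<Rightarrow> 'b::euclidean_space) \<Rightarrow> bool" where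
  "finite_energy u G \<longleftrightarrow> u \<in> borel_measurable M \<and> integrable M (\<lambda>x. (u x)\<^sup>2) \<and>
     integrable M G \<and> integrable M (\<lambda>x. \<phi> x (norm (G x)))"

text \<open>Bochner integrals of nonintegrable functions are 0, so the value is meaningful only
  together with \<open>finite_energy\<close>.\<close>

definition energy :: "('a \<Rightarrow> real) \<Rightarrow> ('a \<Rightarrow> 'b::euclidean_space) \<Rightarrow> real" where
  "energy u G = 1 / 2 * (LINT x|M. (u x - f x)\<^sup>2) + (LINT x|M. \<phi> x (norm (G x)))"

definition area :: "('a \<Rightarrow> 'b::euclidean_space) \<Rightarrow> real" where
  "area G = (LINT x|M. area_integrand (G x))"

definition mid :: "('a \<Rightarrow> 'b::real_vector) \<Rightarrow> ('a \<Rightarrow> 'b) \<Rightarrow> 'a \<Rightarrow> 'b" where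
  "mid u v x = (1 / 2) *\<^sub>R (u x + v x)"

lemma finite_energyD:
  assumes "finite_energy u G"
  shows "u \<in> borel_measurable M" "integrable M (\<lambda>x. (u x)\<^sup>2)" "integrable M G"
    "integrable M (\<lambda>x. \<phi> x (norm (G x)))" "G \<in> borel_measurable M" "integrable M u"
    "integrable M (\<lambda>x. (u x - f x)\<^sup>2)"
proof -
  show *: "u \<in> borel_measurable M" "integrable M (\<lambda>x. (u x)\<^sup>2)" "integrable M G"
    "integrable M (\<lambda>x. \<phi> x (norm (G x)))"
    using assms by (simp_all add: finite_energy_def)
  show "G \<in> borel_measurable M" using *(3) by simp
  show "integrable M u" by (rule integrable_of_square[OF *(1,2)])
  show "integrable M (\<lambda>x. (u x - f x)\<^sup>2)"
    using integrable_square_lincomb[OF *(1) f_measurable *(2) f_square, of 1 "-1"] by simp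
qed

lemma integrable_square_diff:
  assumes "finite_energy u G" "finite_energy v H"
  shows "integrable M (\<lambda>x. (u x - v x)\<^sup>2)"
  using integrable_square_lincomb[OF finite_energyD(1)[OF assms(1)] finite_energyD(1)[OF assms(2)]
    finite_energyD(2)[OF assms(1)] finite_energyD(2)[OF assms(2)], of 1 "-1"]
  by simp

lemma energy_ge:
  assumes "finite_energy u G"
  shows "0 \<le> (LINT x|M. \<phi> x (norm (G x)))" "(LINT x|M. \<phi> x (norm (G x))) \<le> energy u G" "0 \<le> energy u G"
proof -
  show 1: "0 \<le> (LINT x|M. \<phi> x (norm (G x)))"
    by (intro Bochner_Integration.integral_nonneg) (simp add: nonneg)
  have "0 \<le> (LINT x|M. (u x - f x)\<^sup>2)" by simp
  with 1 show "(LINT x|M. \<phi> x (norm (G x))) \<le> energy u G" "0 \<le> energy u G"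
    by (simp_all add: energy_def)
qed

lemma phi_midpoint:
  fixes G H :: "'a \<Rightarrow> 'b::euclidean_space"
  shows "AE x in M. \<phi> x (norm (mid G H x)) \<le> (\<phi> x (norm (G x)) + \<phi> x (norm (H x))) / 2"
  using regular
proof eventually_elim
  case (elim x)
  have "norm (mid G H x) \<le> (norm (G x) + norm (H x)) / 2"
    using norm_triangle_ineq[of "G x" "H x"] by (simp add: mid_def)
  then have "\<phi> x (norm (mid G H x)) \<le> \<phi> x ((norm (G x) + norm (H x)) / 2)"
    using elim by (auto intro!: mono_onD[of "{0..}" "\<phi> x"])
  also have "\<dots> = \<phi> x ((1 - 1/2) *\<^sub>R norm (G x) + (1/2) *\<^sub>R norm (H x))"
    by (simp add: field_simps)
  also have "\<dots> \<le> (1 - 1/2) * \<phi> x (norm (G x)) + (1/2) * \<phi> x (norm (H x))"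
    using elim by (intro convex_onD[of "{0..}"]) auto
  finally show ?case by (simp add: field_simps)
qed

text \<open>The fidelity term contributes the parallelogram identity, whose remainder with factor
  \<open>1 / 4\<close> is halved in the energy. The other term contributes plain convexity, hence no
  control of \<open>G - H\<close>.\<close>

lemma finite_energy_mid:
  fixes G H :: "'a \<Rightarrow> 'b::euclidean_space"
  assumes 1: "finite_energy u G" and 2: "finite_energy v H"
  shows "finite_energy (mid u v) (mid G H)"
    and "energy (mid u v) (mid G H) + 1 / 8 * (LINT x|M. (u x - v x)\<^sup>2) \<le> (energy u G + energy v H) / 2"
proof -
  note [measurable] = finite_energyD(1,5)[OF 1] finite_energyD(1,5)[OF 2]
  note int = finite_energyD[OF 1] finite_energyD[OF 2] integrable_square_diff[OF 1 2]
  have \<phi>: "integrable M (\<lambda>x. \<phi> x (norm (mid G H x)))"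
  proof (rule Bochner_Integration.integrable_bound)
    show "integrable M (\<lambda>x. (\<phi> x (norm (G x)) + \<phi> x (norm (H x))) / 2)"
      using int by simp
    show "(\<lambda>x. \<phi> x (norm (mid G H x))) \<in> borel_measurable M"
      unfolding mid_def by (intro caratheodory) auto
    show "AE x in M. norm (\<phi> x (norm (mid G H x))) \<le> norm ((\<phi> x (norm (G x)) + \<phi> x (norm (H x))) / 2)"
      using phi_midpoint[of G H] AE_space by eventually_elim (simp add: nonneg)
  qed
  have "integrable M (\<lambda>x. (mid u v x)\<^sup>2)"
    using integrable_square_lincomb[of u M v "1/2" "1/2"] int by (simp add: mid_def add_divide_distrib)
  then show "finite_energy (mid u v) (mid G H)"
    using \<phi> int unfolding finite_energy_def mid_def by simp
  have "(mid u v x - f x)\<^sup>2 = ((u x - f x)\<^sup>2 + (v x - f x)\<^sup>2) / 2 - (u x - v x)\<^sup>2 / 4" for x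
    by (simp add: mid_def power2_eq_square field_simps)
  then have "(LINT x|M. (mid u v x - f x)\<^sup>2) =
      ((LINT x|M. (u x - f x)\<^sup>2) + (LINT x|M. (v x - f x)\<^sup>2)) / 2 - (LINT x|M. (u x - v x)\<^sup>2) / 4"
    using int by (simp add: Bochner_Integration.integral_diff Bochner_Integration.integral_add)
  moreover have "(LINT x|M. \<phi> x (norm (mid G H x))) \<le> (LINT x|M. (\<phi> x (norm (G x)) + \<phi> x (norm (H x))) / 2)"
    using \<phi> int phi_midpoint by (intro integral_mono_AE) auto
  ultimately show "energy (mid u v) (mid G H) + 1 / 8 * (LINT x|M. (u x - v x)\<^sup>2) \<le> (energy u G + energy v H) / 2"
    using int by (simp add: energy_def field_simps)
qed

lemma integrable_area:
  fixes G :: "'a \<Rightarrow> 'b::euclidean_space"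
  assumes "integrable M G"
  shows "integrable M (\<lambda>x. area_integrand (G x))"
proof (rule Bochner_Integration.integrable_bound)
  show "integrable M (\<lambda>x. 1 + norm (G x))" using assms by simp
  show "AE x in M. norm (area_integrand (G x)) \<le> norm (1 + norm (G x))"
    using area_integrand_bounds[of "G _"] by (intro AE_I2) (simp add: order_trans[OF zero_le_one])
qed (use assms in measurable)

lemma area_nonneg: "0 \<le> area G"
  unfolding area_def
  by (intro Bochner_Integration.integral_nonneg order_trans[OF zero_le_one area_integrand_bounds(1)])

text \<open>Superlinearity with \<open>\<eta> = 1\<close> bounds \<open>norm (G x)\<close> by
  \<open>T + \<phi> x (norm (G x))\<close>. The constant is uniform in \<open>u\<close> and
  \<open>G\<close>, so infima of the area over nonempty energy sublevel sets stay bounded.\<close>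

lemma area_le_energy: "\<exists>C. \<forall>u (G :: 'a \<Rightarrow> 'b::euclidean_space). finite_energy u G \<longrightarrow> area G \<le> C + energy u G"
proof -
  obtain T where T: "T \<ge> 0" "AE x in M. \<forall>t\<ge>T. t \<le> 1 * \<phi> x t"
    using superlinear[of 1] by auto
  have "area G \<le> (LINT x|M. 1 + T) + energy u G" if e: "finite_energy u G" for u and G :: "'a \<Rightarrow> 'b"
  proof -
    have "area G \<le> (LINT x|M. 1 + T + \<phi> x (norm (G x)))"
      unfolding area_def
    proof (rule integral_mono_AE)
      show "AE x in M. area_integrand (G x) \<le> 1 + T + \<phi> x (norm (G x))"
        using T(2) AE_space
      proof eventually_elim
        case (elim x)
        then have "norm (G x) \<le> T + \<phi> x (norm (G x))"
          using T(1) nonneg[of x "norm (G x)"] by (cases "norm (G x) \<ge> T") auto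
        with area_integrand_bounds(2)[of "G x"] show ?case by simp
      qed
    qed (use finite_energyD[OF e] integrable_area in auto)
    also have "\<dots> = (LINT x|M. 1 + T) + (LINT x|M. \<phi> x (norm (G x)))"
      using finite_energyD[OF e] by (subst Bochner_Integration.integral_add) auto
    finally show ?thesis using energy_ge[OF e] by simp
  qed
  then show ?thesis by blast
qed

text \<open>The three terms are meant to be made small in this sense: choose
  \<open>\<epsilon>\<close> and \<open>\<eta>\<close>, which determines \<open>T\<close>, and only
  then ask for a small area gap.\<close>

lemma L1_distance_le:
  fixes G H :: "'a \<Rightarrow> 'b::euclidean_space"
  assumes 1: "finite_energy u G" and 2: "finite_energy v H" and "\<epsilon> > 0" "\<eta> \<ge> 0" "T \<ge> 0"
    and T: "AE x in M. \<forall>t\<ge>T. t \<le> \<eta> * \<phi> x t"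
  shows "(LINT x|M. norm (G x - H x)) \<le> \<epsilon> * measure M (space M)
    + 8 * (1 + T) ^ 3 / \<epsilon> * ((area G + area H) / 2 - area (mid G H))
    + 2 * \<eta> * (energy u G + energy v H)"
proof -
  note int = finite_energyD[OF 1] finite_energyD[OF 2]
  have mid: "integrable M (\<lambda>x. mid G H x)" using int unfolding mid_def by simp
  note area_int = integrable_area[OF int(3)] integrable_area[OF int(10)] integrable_area[OF mid]
  let ?gap = "\<lambda>x. (area_integrand (G x) + area_integrand (H x)) / 2 - area_integrand (mid G H x)"
  let ?tail = "\<lambda>x. \<phi> x (norm (G x)) + \<phi> x (norm (H x))"
  have ints: "integrable M ?gap" "integrable M ?tail" using area_int int by auto
  have lin: "(LINT x|M. c + k * g x + l * h x) =
      c * measure M (space M) + k * (LINT x|M. g x) + l * (LINT x|M. h x)"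
    if "integrable M g" "integrable M h" for g h :: "'a \<Rightarrow> real" and c k l
    using that by (simp add: mult.commute)
  have "(LINT x|M. norm (G x - H x)) \<le> (LINT x|M. \<epsilon> + 8 * (1 + T) ^ 3 / \<epsilon> * ?gap x + 2 * \<eta> * ?tail x)"
  proof (rule integral_mono_AE)
    show "AE x in M. norm (G x - H x) \<le> \<epsilon> + 8 * (1 + T) ^ 3 / \<epsilon> * ?gap x + 2 * \<eta> * ?tail x"
      using T AE_space
    proof eventually_elim
      case (elim x)
      then show ?case
        unfolding mid_def using assms(3-5) by (intro norm_diff_le_area_gap) (auto simp: nonneg)
    qed
    show "integrable M (\<lambda>x. \<epsilon> + 8 * (1 + T) ^ 3 / \<epsilon> * ?gap x + 2 * \<eta> * ?tail x)"
      by (intro Bochner_Integration.integrable_add integrable_mult_right ints integrable_const)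
  qed (use int in auto)
  also have "\<dots> = \<epsilon> * measure M (space M) + 8 * (1 + T) ^ 3 / \<epsilon> * (LINT x|M. ?gap x) + 2 * \<eta> * (LINT x|M. ?tail x)"
    by (rule lin[OF ints])
  also have "(LINT x|M. ?gap x) = (area G + area H) / 2 - area (mid G H)"
    using area_int by (simp add: area_def)
  also have "(LINT x|M. ?tail x) = (LINT x|M. \<phi> x (norm (G x))) + (LINT x|M. \<phi> x (norm (H x)))"
    using int by simp
  finally have "(LINT x|M. norm (G x - H x)) \<le> \<epsilon> * measure M (space M)
    + 8 * (1 + T) ^ 3 / \<epsilon> * ((area G + area H) / 2 - area (mid G H))
    + 2 * \<eta> * ((LINT x|M. \<phi> x (norm (G x))) + (LINT x|M. \<phi> x (norm (H x))))" .
  also have "\<dots> \<le> \<epsilon> * measure M (space M)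
    + 8 * (1 + T) ^ 3 / \<epsilon> * ((area G + area H) / 2 - area (mid G H))
    + 2 * \<eta> * (energy u G + energy v H)"
    using energy_ge[OF 1] energy_ge[OF 2] \<open>\<eta> \<ge> 0\<close> by (intro add_left_mono mult_left_mono add_mono) auto
  finally show ?thesis .
qed

lemma L1_distance_le_square:
  assumes 1: "finite_energy u G" and 2: "finite_energy v H" and "\<epsilon> > 0"
  shows "(LINT x|M. norm (u x - v x)) \<le> \<epsilon> * measure M (space M) + (LINT x|M. (u x - v x)\<^sup>2) / \<epsilon>"
proof -
  note int = finite_energyD[OF 1] finite_energyD[OF 2] integrable_square_diff[OF 1 2]
  \<comment> \<open>An elementary substitute for the Cauchy-Schwarz inequality, obtained from
    \<open>(\<bar>t\<bar> - \<epsilon>)\<^sup>2 \<ge> 0\<close>.\<close>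
  have *: "\<bar>t\<bar> \<le> \<epsilon> + t\<^sup>2 / \<epsilon>" for t :: real
  proof -
    have "0 \<le> (\<bar>t\<bar> - \<epsilon>)\<^sup>2" "0 \<le> \<bar>t\<bar> * \<epsilon>" using \<open>\<epsilon> > 0\<close> by auto
    then have "\<bar>t\<bar> * \<epsilon> \<le> \<epsilon> * \<epsilon> + t\<^sup>2" by (simp add: power2_eq_square algebra_simps)
    with \<open>\<epsilon> > 0\<close> show ?thesis by (simp add: field_simps)
  qed
  have "(LINT x|M. norm (u x - v x)) \<le> (LINT x|M. \<epsilon> + (u x - v x)\<^sup>2 / \<epsilon>)"
    using int * by (intro integral_mono) auto
  then show ?thesis using int by (simp add: mult.commute)
qed

text \<open>Fatou's lemma is applied to the whole integrand at once, which yields finiteness of the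
  limit energy along with the inequality. The integrands converge pointwise by almost everywhere
  convergence of \<open>u n\<close> and \<open>G n\<close> and continuity of
  \<open>\<phi> x\<close>.\<close>

lemma energy_lower_semicontinuous:
  fixes G :: "nat \<Rightarrow> 'a \<Rightarrow> 'b::euclidean_space"
  assumes fin: "\<And>n. finite_energy (u n) (G n)"
    and u: "AE x in M. (\<lambda>n. u n x) \<longlonglongrightarrow> v x" and G: "AE x in M. (\<lambda>n. G n x) \<longlonglongrightarrow> H x"
    and v [measurable]: "v \<in> borel_measurable M" and H: "integrable M H"
    and lim: "(\<lambda>n. energy (u n) (G n)) \<longlonglongrightarrow> I"
  shows "finite_energy v H" "energy v H \<le> I"
proof -
  have [measurable]: "H \<in> borel_measurable M" using H by auto
  have [measurable]: "(\<lambda>x. \<phi> x (norm (H x))) \<in> borel_measurable M"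
    by (intro caratheodory) auto
  define q where "q w K x = 1 / 2 * (w x - f x)\<^sup>2 + \<phi> x (norm (K x))" for w and K :: "'a \<Rightarrow> 'b" and x
  have q: "integrable M (q (u n) (G n))" "(LINT x|M. q (u n) (G n) x) = energy (u n) (G n)" for n
    using finite_energyD[OF fin[of n]] unfolding q_def energy_def by auto
  have q_nonneg: "0 \<le> q w K x" if "x \<in> space M" for w K x
    using that by (simp add: q_def nonneg)
  have [measurable]: "q v H \<in> borel_measurable M" unfolding q_def by measurable
  have "(\<integral>\<^sup>+x. q v H x \<partial>M) = (\<integral>\<^sup>+x. liminf (\<lambda>n. ennreal (q (u n) (G n) x)) \<partial>M)"
  proof (rule nn_integral_cong_AE, use u G regular in eventually_elim)
    case (elim x)
    have "(\<lambda>n. \<phi> x (norm (G n x))) \<longlonglongrightarrow> \<phi> x (norm (H x))"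
      using elim by (intro continuous_on_tendsto_compose[of "{0..}" "\<phi> x"]) (auto intro: tendsto_norm)
    then have "(\<lambda>n. ennreal (q (u n) (G n) x)) \<longlonglongrightarrow> ennreal (q v H x)"
      unfolding q_def by (intro tendsto_intros elim)
    then show ?case by (metis lim_imp_Liminf trivial_limit_sequentially)
  qed
  also have "\<dots> \<le> liminf (\<lambda>n. \<integral>\<^sup>+x. q (u n) (G n) x \<partial>M)"
    using q(1) by (intro nn_integral_liminf) auto
  also have "(\<lambda>n. \<integral>\<^sup>+x. q (u n) (G n) x \<partial>M) = (\<lambda>n. ennreal (energy (u n) (G n)))"
    using q q_nonneg by (subst nn_integral_eq_integral) auto
  also have "liminf \<dots> = ennreal I"
    by (rule lim_imp_Liminf) (auto intro!: tendsto_intros lim)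
  finally have le: "(\<integral>\<^sup>+x. q v H x \<partial>M) \<le> ennreal I" .
  have "AE x in M. 0 \<le> q v H x" using q_nonneg by auto
  then have int: "integrable M (q v H)"
    using le by (intro integrableI_nonneg) (auto simp: less_top[symmetric] top_unique)
  have 1: "integrable M (\<lambda>x. (v x - f x)\<^sup>2)"
    by (rule Bochner_Integration.integrable_bound[OF integrable_mult_right[OF int, of 2]])
      (auto simp: q_def nonneg)
  have 2: "integrable M (\<lambda>x. \<phi> x (norm (H x)))"
    by (rule Bochner_Integration.integrable_bound[OF int]) (auto simp: q_def nonneg)
  have "integrable M (\<lambda>x. (1 * (v x - f x) + 1 * f x)\<^sup>2)"
    using 1 f_square by (intro integrable_square_lincomb) auto
  with 1 2 H v show "finite_energy v H" by (simp add: finite_energy_def)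
  have "energy v H = (LINT x|M. q v H x)"
    using 1 2 by (simp add: energy_def q_def)
  moreover have "0 \<le> I"
    using lim energy_ge(3)[OF fin] by (intro LIMSEQ_le_const[OF lim]) auto
  ultimately show "energy v H \<le> I"
    using le int q_nonneg by (subst (asm) nn_integral_eq_integral) auto
qed

end

text \<open>The Cauchy estimates are obtained for ordered indices only, because a midpoint is
  located in the larger of two nested sublevel sets.\<close>

lemma eventually_small_symmetric:
  fixes d :: "nat \<Rightarrow> nat \<Rightarrow> real"
  assumes sym: "\<And>i j. d i j = d j i" and ev: "\<exists>N. \<forall>n\<ge>N. \<forall>k\<ge>n. d n k < e"
  shows "\<exists>N. \<forall>i\<ge>N. \<forall>j\<ge>N. d i j < e"
  using assms by (metis nat_le_linear)

section \<open>Existence and uniqueness of minimizers in the abstract setting\<close>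

context superlinear_energy
begin

text \<open>\<open>P\<close> stands for the admissible pairs. Closedness is asked only for limits of
  finite energy, since lower semicontinuity supplies that finiteness first.\<close>

theorem minimizer_exists:
  fixes P :: "(('a \<Rightarrow> real) \<times> ('a \<Rightarrow> 'b::euclidean_space)) set"
  assumes ne: "P \<noteq> {}" and fin: "\<And>u G. (u, G) \<in> P \<Longrightarrow> finite_energy u G"
    and mid: "\<And>u G v H. (u, G) \<in> P \<Longrightarrow> (v, H) \<in> P \<Longrightarrow> (mid u v, mid G H) \<in> P"
    and closed: "\<And>u G v H. (\<And>n. (u n, G n) \<in> P) \<Longrightarrow> finite_energy v H \<Longrightarrow>
      (\<lambda>n. LINT x|M. norm (u n x - v x)) \<longlonglongrightarrow> 0 \<Longrightarrow>
      (\<lambda>n. LINT x|M. norm (G n x - H x)) \<longlonglongrightarrow> 0 \<Longrightarrow> (v, H) \<in> P"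
  shows "\<exists>u G. (u, G) \<in> P \<and> (\<forall>v H. (v, H) \<in> P \<longrightarrow> energy u G \<le> energy v H)"
proof -
  define m where "m = (INF p\<in>P. energy (fst p) (snd p))"
  have bdd: "bdd_below ((\<lambda>p. energy (fst p) (snd p)) ` P)"
    using energy_ge(3)[OF fin] by (intro bdd_belowI2[where m=0]) auto
  have m_le: "m \<le> energy u G" if "(u, G) \<in> P" for u G
    using cINF_lower[OF bdd that] by (simp add: m_def)
  have m_nonneg: "0 \<le> m"
    unfolding m_def using ne energy_ge(3)[OF fin] by (intro cINF_greatest) auto
  define S where "S n = {p \<in> P. energy (fst p) (snd p) \<le> m + 1 / real (Suc n)}" for n
  have S_ne: "S n \<noteq> {}" for n
  proof -
    have "m < m + 1 / real (Suc n)" by simp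
    then obtain p where "p \<in> P" "energy (fst p) (snd p) < m + 1 / real (Suc n)"
      using cINF_less_iff[OF ne bdd] unfolding m_def by blast
    then have "p \<in> S n" by (simp add: S_def)
    then show ?thesis by blast
  qed
  have S_mono: "S k \<subseteq> S n" if "n \<le> k" for n k
  proof -
    have "1 / real (Suc k) \<le> 1 / real (Suc n)" using that by (simp add: frac_le)
    then show ?thesis by (auto simp: S_def)
  qed
  \<comment> \<open>\<open>S n\<close> shrinks with \<open>n\<close>, so these infima increase; by
    \<open>area_le_energy\<close> they are bounded, so they form a Cauchy sequence.\<close>
  define a where "a n = (INF p\<in>S n. area (snd p))" for n
  have bdd_a: "bdd_below ((\<lambda>p. area (snd p)) ` S n)" for n
    using area_nonneg by (intro bdd_belowI2[where m=0]) auto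
  have "\<exists>p\<in>S n. area (snd p) < a n + 1 / real (Suc n)" for n
  proof -
    have "a n < a n + 1 / real (Suc n)" by simp
    then show ?thesis
      using cINF_less_iff[OF S_ne bdd_a] unfolding a_def by blast
  qed
  then obtain p where p: "\<And>n. p n \<in> S n" "\<And>n. area (snd (p n)) < a n + 1 / real (Suc n)"
    by metis
  define u G where "u n = fst (p n)" and "G n = snd (p n)" for n
  have uG: "(u n, G n) \<in> S n" for n using p(1) by (simp add: u_def G_def)
  then have P: "(u n, G n) \<in> P" and energy_le: "energy (u n) (G n) \<le> m + 1 / real (Suc n)" for n
    by (auto simp: S_def)
  note fin_n = fin[OF P]
  obtain C where C: "\<And>v (H :: 'a \<Rightarrow> 'b). finite_energy v H \<Longrightarrow> area H \<le> C + energy v H"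
    using area_le_energy by blast
  have a_mono: "a n \<le> a k" if "n \<le> k" for n k
    unfolding a_def by (intro cINF_superset_mono S_ne bdd_a S_mono that order_refl)
  have a_bound: "a n \<le> C + (m + 1)" for n
  proof -
    have "a n \<le> area (G n)" using cINF_lower[OF bdd_a uG] by (simp add: a_def)
    also have "\<dots> \<le> C + energy (u n) (G n)" by (rule C[OF fin_n])
    also have "energy (u n) (G n) \<le> m + 1" by (rule order_trans[OF energy_le]) simp
    finally show ?thesis by simp
  qed
  have "convergent a"
    by (rule incseq_convergent[of a "C + (m + 1)"])
      (auto simp: incseq_def a_mono a_bound convergentI)
  then have a_cauchy: "\<exists>N. \<forall>n\<ge>N. \<forall>k\<ge>N. \<bar>a n - a k\<bar> < e" if "e > 0" for e
    using that by (simp add: Cauchy_convergent_iff[symmetric] Cauchy_def dist_real_def)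
  have small: "\<exists>N. \<forall>n\<ge>N. 1 / real (Suc n) < e" if "e > 0" for e
    using order_tendstoD(2)[OF LIMSEQ_Suc[OF lim_1_over_n] that] by (simp add: eventually_sequentially)
  \<comment> \<open>Both pairs lie in the larger set \<open>S n\<close>, which is midpoint convex.
    The midpoint has energy at least \<open>m\<close>, so the quadratic remainder with factor
    \<open>1 / 8\<close> is at most \<open>1 / real (Suc n)\<close>.\<close>
  have mid_S: "(mid (u n) (u k), mid (G n) (G k)) \<in> S n"
    and square_gap: "(LINT x|M. (u n x - u k x)\<^sup>2) \<le> 8 / real (Suc n)" if "n \<le> k" for n k
  proof -
    have "energy (u n) (G n) \<le> m + 1 / real (Suc n)" "energy (u k) (G k) \<le> m + 1 / real (Suc n)"
      using uG[of n] uG[of k] S_mono[OF that] by (auto simp: S_def)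
    with finite_energy_mid(2)[OF fin_n fin_n, of n k]
    have *: "energy (mid (u n) (u k)) (mid (G n) (G k)) + 1 / 8 * (LINT x|M. (u n x - u k x)\<^sup>2) \<le> m + 1 / real (Suc n)"
      by argo
    have "0 \<le> (LINT x|M. (u n x - u k x)\<^sup>2)" by simp
    with * have "energy (mid (u n) (u k)) (mid (G n) (G k)) \<le> m + 1 / real (Suc n)"
      by argo
    with mid[OF P P] show "(mid (u n) (u k), mid (G n) (G k)) \<in> S n"
      by (simp add: S_def)
    show "(LINT x|M. (u n x - u k x)\<^sup>2) \<le> 8 / real (Suc n)"
      using * m_le[OF mid[OF P P], of n k] by simp
  qed
  \<comment> \<open>The midpoint competes for \<open>a n\<close>, while the two areas exceed
    \<open>a n\<close> and \<open>a k\<close> by less than \<open>1 / real (Suc n)\<close>;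
    averaging leaves half of \<open>a k - a n\<close> plus this error.\<close>
  have area_gap: "(area (G n) + area (G k)) / 2 - area (mid (G n) (G k)) \<le> \<bar>a n - a k\<bar> + 1 / real (Suc n)"
    if "n \<le> k" for n k
  proof -
    have "a n \<le> area (mid (G n) (G k))"
      using cINF_lower[OF bdd_a mid_S[OF that]] by (simp add: a_def)
    moreover have "area (G n) < a n + 1 / real (Suc n)" "area (G k) < a k + 1 / real (Suc k)"
      using p(2) by (auto simp: G_def)
    moreover have "1 / real (Suc k) \<le> 1 / real (Suc n)" using that by (simp add: frac_le)
    moreover have "\<bar>a n - a k\<bar> = a k - a n" using a_mono[OF that] by simp
    ultimately show ?thesis by argo
  qed
  define \<mu> where "\<mu> = measure M (space M)"
  have "\<mu> \<ge> 0" by (simp add: \<mu>_def)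
  \<comment> \<open>Each error term below is allotted a quarter of \<open>e\<close>;
    \<open>\<mu> + 1\<close> in place of \<open>\<mu>\<close> avoids division by 0 for a null
    measure.\<close>
  have \<epsilon>: "e / (4 * (\<mu> + 1)) > 0" "e / (4 * (\<mu> + 1)) * \<mu> \<le> e / 4" if "e > 0" for e
    using that \<open>\<mu> \<ge> 0\<close> by (auto simp: field_simps)

  have u_cauchy: "\<exists>N. \<forall>i\<ge>N. \<forall>j\<ge>N. (LINT x|M. norm (u i x - u j x)) < e" if e: "e > 0" for e
  proof (rule eventually_small_symmetric)
    define \<epsilon> where "\<epsilon> = e / (4 * (\<mu> + 1))"
    have eps: "\<epsilon> > 0" "\<epsilon> * \<mu> \<le> e / 4" using \<epsilon>[OF e] by (simp_all add: \<epsilon>_def)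
    \<comment> \<open>The bound \<open>8 / real (Suc n)\<close> from \<open>square_gap\<close>,
      divided by \<open>\<epsilon>\<close>, has to drop below \<open>e / 4\<close>.\<close>
    obtain N where N: "\<And>n. n \<ge> N \<Longrightarrow> 1 / real (Suc n) < e * \<epsilon> / 32"
      using small[of "e * \<epsilon> / 32"] e eps by auto
    have "(LINT x|M. norm (u n x - u k x)) < e" if "n \<ge> N" "k \<ge> n" for n k
    proof -
      have "(LINT x|M. (u n x - u k x)\<^sup>2) < e * \<epsilon> / 4"
        using square_gap[OF that(2)] N[OF that(1)] by simp
      then have "(LINT x|M. (u n x - u k x)\<^sup>2) / \<epsilon> < e / 4"
        using eps by (simp add: field_simps)
      moreover have "(LINT x|M. norm (u n x - u k x)) \<le> \<epsilon> * \<mu> + (LINT x|M. (u n x - u k x)\<^sup>2) / \<epsilon>"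
        unfolding \<mu>_def by (rule L1_distance_le_square[OF fin_n fin_n eps(1)])
      ultimately show ?thesis using eps(2) e by linarith
    qed
    then show "\<exists>N. \<forall>n\<ge>N. \<forall>k\<ge>n. (LINT x|M. norm (u n x - u k x)) < e" by blast
  qed (simp add: abs_minus_commute)

  have G_cauchy: "\<exists>N. \<forall>i\<ge>N. \<forall>j\<ge>N. (LINT x|M. norm (G i x - G j x)) < e" if e: "e > 0" for e
  proof (rule eventually_small_symmetric)
    define \<epsilon> where "\<epsilon> = e / (4 * (\<mu> + 1))"
    have eps: "\<epsilon> > 0" "\<epsilon> * \<mu> \<le> e / 4" using \<epsilon>[OF e] by (simp_all add: \<epsilon>_def)
    \<comment> \<open>Energies are at most \<open>m + 1\<close>, so the tail is bounded by
      \<open>2 * \<eta> * (2 * (m + 1))\<close>, which is \<open>e / 4\<close>.\<close>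
    define \<eta> where "\<eta> = e / (16 * (m + 1))"
    have eta: "\<eta> > 0" using e m_nonneg by (simp add: \<eta>_def)
    obtain T where T: "T \<ge> 0" "AE x in M. \<forall>t\<ge>T. t \<le> \<eta> * \<phi> x t"
      using superlinear[OF eta] by blast
    \<comment> \<open>\<open>K\<close> may be huge, since \<open>T\<close> depends on
      \<open>\<eta>\<close>, but it is fixed before the indices, which then bring the area gap below
      \<open>e / (4 * K)\<close>.\<close>
    define K where "K = 8 * (1 + T) ^ 3 / \<epsilon>"
    have K: "K > 0" using T eps by (simp add: K_def)
    obtain N1 where N1: "\<And>n k. \<lbrakk>n \<ge> N1; k \<ge> N1\<rbrakk> \<Longrightarrow> \<bar>a n - a k\<bar> < e / (8 * K)"
      using a_cauchy[of "e / (8 * K)"] e K by (auto simp del: divide_less_eq)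
    obtain N2 where N2: "\<And>n. n \<ge> N2 \<Longrightarrow> 1 / real (Suc n) < e / (8 * K)"
      using small[of "e / (8 * K)"] e K by auto
    have "(LINT x|M. norm (G n x - G k x)) < e" if "n \<ge> max N1 N2" "k \<ge> n" for n k
    proof -
      let ?gap = "(area (G n) + area (G k)) / 2 - area (mid (G n) (G k))"
      have "?gap < e / (8 * K) + e / (8 * K)"
        using area_gap[OF that(2)] N1[of n k] N2[of n] that by simp
      then have "K * ?gap < K * (e / (8 * K) + e / (8 * K))"
        using K by (intro mult_strict_left_mono)
      also have "\<dots> = e / 4" using K by (simp add: field_simps)
      finally have gap: "K * ?gap < e / 4" .
      have "energy (u i) (G i) \<le> m + 1" for i
        by (rule order_trans[OF energy_le]) simp
      from add_mono[OF this[of n] this[of k]]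
      have "2 * \<eta> * (energy (u n) (G n) + energy (u k) (G k)) \<le> 2 * \<eta> * ((m + 1) + (m + 1))"
        using eta by (intro mult_left_mono) auto
      also have "\<dots> = e / 4" using m_nonneg by (simp add: \<eta>_def field_simps)
      finally have tail: "2 * \<eta> * (energy (u n) (G n) + energy (u k) (G k)) \<le> e / 4" .
      have "(LINT x|M. norm (G n x - G k x)) \<le> \<epsilon> * \<mu> + K * ?gap
          + 2 * \<eta> * (energy (u n) (G n) + energy (u k) (G k))"
        unfolding \<mu>_def K_def using eps eta T
        by (intro L1_distance_le[OF fin_n fin_n]) auto
      with eps gap tail e show ?thesis by linarith
    qed
    then show "\<exists>N. \<forall>n\<ge>N. \<forall>k\<ge>n. (LINT x|M. norm (G n x - G k x)) < e" by blast
  qed (simp add: norm_minus_commute)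

  obtain r v where r: "strict_mono r" and v: "integrable M v" "AE x in M. (\<lambda>i. u (r i) x) \<longlonglongrightarrow> v x"
      "(\<lambda>n. LINT x|M. norm (u n x - v x)) \<longlonglongrightarrow> 0"
    by (rule L1_cauchy_limit[of M u, OF finite_energyD(6)[OF fin_n] u_cauchy]) (assumption | rule that)+
  \<comment> \<open>The second extraction is made inside the first, so that both components converge
    almost everywhere along \<open>r \<circ> s\<close>.\<close>
  have Gr_cauchy: "\<exists>N. \<forall>i\<ge>N. \<forall>j\<ge>N. (LINT x|M. norm (G (r i) x - G (r j) x)) < e" if e: "e > 0" for e
  proof -
    obtain N where "\<forall>i\<ge>N. \<forall>j\<ge>N. (LINT x|M. norm (G i x - G j x)) < e"
      using G_cauchy[OF e] by (rule exE)
    moreover have "r i \<ge> N" if "i \<ge> N" for i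
      using seq_suble[OF r, of i] that by simp
    ultimately show ?thesis by (intro exI[of _ N]) simp
  qed
  obtain s H where s: "strict_mono s" and H: "integrable M H" "AE x in M. (\<lambda>i. G (r (s i)) x) \<longlonglongrightarrow> H x"
      "(\<lambda>n. LINT x|M. norm (G (r n) x - H x)) \<longlonglongrightarrow> 0"
    by (rule L1_cauchy_limit[of M "\<lambda>i. G (r i)", OF finite_energyD(3)[OF fin_n] Gr_cauchy]) (assumption | rule that)+
  have rs: "strict_mono (r \<circ> s)" using r s by (rule strict_mono_o)
  have v': "AE x in M. (\<lambda>i. u (r (s i)) x) \<longlonglongrightarrow> v x"
    using v(2) by eventually_elim (use LIMSEQ_subseq_LIMSEQ[OF _ s] in \<open>auto simp: o_def\<close>)
  have energy_lim: "(\<lambda>i. energy (u i) (G i)) \<longlonglongrightarrow> m"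
  proof (rule tendsto_sandwich[of "\<lambda>_. m" _ _ "\<lambda>n. m + 1 / real (Suc n)"])
    have "(\<lambda>n. m + 1 / real (Suc n)) \<longlonglongrightarrow> m + 0"
      by (intro tendsto_intros LIMSEQ_Suc[OF lim_1_over_n])
    then show "(\<lambda>n. m + 1 / real (Suc n)) \<longlonglongrightarrow> m" by simp
  qed (use m_le[OF P] energy_le in auto)
  have energy_lim': "(\<lambda>i. energy (u (r (s i))) (G (r (s i)))) \<longlonglongrightarrow> m"
    using LIMSEQ_subseq_LIMSEQ[OF energy_lim rs] by (simp add: o_def)
  have vm: "v \<in> borel_measurable M" using v(1) by simp
  note lsc = energy_lower_semicontinuous[OF fin_n v' H(2) vm H(1) energy_lim']
  have "(v, H) \<in> P"
  proof (rule closed[OF P[of "r (s _)"]])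
    show "finite_energy v H" by (rule lsc)
    show "(\<lambda>n. LINT x|M. norm (u (r (s n)) x - v x)) \<longlonglongrightarrow> 0"
      using LIMSEQ_subseq_LIMSEQ[OF v(3) rs] by (simp add: o_def)
    show "(\<lambda>n. LINT x|M. norm (G (r (s n)) x - H x)) \<longlonglongrightarrow> 0"
      using LIMSEQ_subseq_LIMSEQ[OF H(3) s] by (simp add: o_def)
  qed
  moreover have "energy v H \<le> energy w K" if "(w, K) \<in> P" for w K
    using lsc(2) m_le[OF that] by simp
  ultimately show ?thesis by blast
qed

text \<open>If the midpoint is no better than either pair, the quadratic remainder in
  \<open>finite_energy_mid\<close> must vanish.\<close>

theorem minimizer_unique:
  fixes G H :: "'a \<Rightarrow> 'b::euclidean_space"
  assumes 1: "finite_energy u G" and 2: "finite_energy v H"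
    and "energy u G \<le> energy (mid u v) (mid G H)" "energy v H \<le> energy (mid u v) (mid G H)"
  shows "AE x in M. v x = u x"
proof -
  have "(LINT x|M. (u x - v x)\<^sup>2) \<le> 0"
    using finite_energy_mid(2)[OF 1 2] assms(3,4) by argo
  then have "(LINT x|M. (u x - v x)\<^sup>2) = 0" by (simp add: antisym)
  then have "AE x in M. (u x - v x)\<^sup>2 = 0"
    by (subst (asm) integral_nonneg_eq_0_iff_AE[OF integrable_square_diff[OF 1 2]]) auto
  then show ?thesis by eventually_elim simp
qed

end

section \<open>Weak gradients of midpoints and limits\<close>

lemma integrable_imp_locally_integrable:
  fixes g :: "'a::euclidean_space \<Rightarrow> 'b::euclidean_space"
  assumes \<Omega>: "\<Omega> \<in> sets lebesgue" and g: "integrable (lebesgue_on \<Omega>) g"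
  shows "locally_integrable \<Omega> g"
  unfolding locally_integrable_def
proof (intro allI impI)
  fix K assume K: "compact K \<and> K \<subseteq> \<Omega>"
  then have Ks: "K \<in> sets lebesgue" by (simp add: borel_compact)
  have "integrable lebesgue (\<lambda>x. if x \<in> \<Omega> then g x else 0)"
    using g \<Omega> by (simp add: Lebesgue_Measure.integrable_restrict_UNIV)
  from integrable_mult_indicator[OF Ks this]
  have "integrable lebesgue (\<lambda>x. if x \<in> K then g x else 0)"
    by (rule Bochner_Integration.integrable_cong[THEN iffD1, rotated 2]) (use K in \<open>auto simp: indicator_def\<close>)
  then show "integrable (lebesgue_on K) g"
    using Ks by (simp add: Lebesgue_Measure.integrable_restrict_UNIV)
qed

text \<open>Written with \<open>(1 / 2) *\<^sub>R\<close> so that both functions are unfoldings of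
  \<open>mid\<close>. The compact support of test functions supplies the integrability that
  linearity of the integral asks for.\<close>

lemma is_weak_gradient_midpoint:
  fixes \<Omega> :: "'a::euclidean_space set"
  assumes "\<Omega> \<in> sets lebesgue" and u: "is_weak_gradient \<Omega> u G" and v: "is_weak_gradient \<Omega> v H"
  shows "is_weak_gradient \<Omega> (\<lambda>x. (1 / 2) *\<^sub>R (u x + v x)) (\<lambda>x. (1 / 2) *\<^sub>R (G x + H x))"
  unfolding is_weak_gradient_def
proof (intro conjI allI impI ballI)
  have loc: "locally_integrable \<Omega> u" "locally_integrable \<Omega> v" "locally_integrable \<Omega> G" "locally_integrable \<Omega> H"
    using u v by (auto simp: is_weak_gradient_def)
  then show "locally_integrable \<Omega> (\<lambda>x. (1 / 2) *\<^sub>R (u x + v x))"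
    "locally_integrable \<Omega> (\<lambda>x. (1 / 2) *\<^sub>R (G x + H x))"
    by (auto simp: locally_integrable_def)
  fix \<psi> i assume \<psi>: "test_function \<Omega> \<psi>" and i: "i \<in> (Basis :: 'a set)"
  have loc': "locally_integrable \<Omega> (\<lambda>x. G x \<bullet> i)" "locally_integrable \<Omega> (\<lambda>x. H x \<bullet> i)"
    using loc by (auto simp: locally_integrable_def)
  note int = integrable_times_test_function[OF test_function_partial[OF \<psi> i] loc(1) assms(1)]
    integrable_times_test_function[OF test_function_partial[OF \<psi> i] loc(2) assms(1)]
    integrable_times_test_function[OF \<psi> loc'(1) assms(1)]
    integrable_times_test_function[OF \<psi> loc'(2) assms(1)]
  have eqs: "(LINT x|lebesgue_on \<Omega>. u x * frechet_derivative \<psi> (at x) i) = - (LINT x|lebesgue_on \<Omega>. (G x \<bullet> i) * \<psi> x)"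
    "(LINT x|lebesgue_on \<Omega>. v x * frechet_derivative \<psi> (at x) i) = - (LINT x|lebesgue_on \<Omega>. (H x \<bullet> i) * \<psi> x)"
    using u v \<psi> i unfolding is_weak_gradient_def by blast+
  have "(LINT x|lebesgue_on \<Omega>. (1 / 2) *\<^sub>R (u x + v x) * frechet_derivative \<psi> (at x) i) =
    (LINT x|lebesgue_on \<Omega>. 1 / 2 * (u x * frechet_derivative \<psi> (at x) i + v x * frechet_derivative \<psi> (at x) i))"
    by (intro Bochner_Integration.integral_cong refl) (simp add: algebra_simps)
  also have "\<dots> = 1 / 2 * ((LINT x|lebesgue_on \<Omega>. u x * frechet_derivative \<psi> (at x) i) +
      (LINT x|lebesgue_on \<Omega>. v x * frechet_derivative \<psi> (at x) i))"
    using int by simp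
  also have "\<dots> = - (1 / 2 * ((LINT x|lebesgue_on \<Omega>. (G x \<bullet> i) * \<psi> x) +
      (LINT x|lebesgue_on \<Omega>. (H x \<bullet> i) * \<psi> x)))"
    unfolding eqs by (simp add: field_simps)
  also have "\<dots> = - (LINT x|lebesgue_on \<Omega>. 1 / 2 * ((G x \<bullet> i) * \<psi> x + (H x \<bullet> i) * \<psi> x))"
    using int by simp
  also have "\<dots> = - (LINT x|lebesgue_on \<Omega>. ((1 / 2) *\<^sub>R (G x + H x)) \<bullet> i * \<psi> x)"
    by (intro arg_cong[where f=uminus] Bochner_Integration.integral_cong refl)
      (simp add: inner_add_left algebra_simps)
  finally show "(LINT x|lebesgue_on \<Omega>. (1 / 2) *\<^sub>R (u x + v x) * frechet_derivative \<psi> (at x) i) =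
    - (LINT x|lebesgue_on \<Omega>. ((1 / 2) *\<^sub>R (G x + H x)) \<bullet> i * \<psi> x)" .
qed

lemma integral_times_bounded_tendsto:
  fixes u :: "nat \<Rightarrow> 'a \<Rightarrow> real"
  assumes u: "\<And>n. integrable M (u n)" and v: "integrable M v"
    and lim: "(\<lambda>n. LINT x|M. norm (u n x - v x)) \<longlonglongrightarrow> 0"
    and \<psi>: "\<psi> \<in> borel_measurable M" "\<And>x. norm (\<psi> x) \<le> B"
  shows "(\<lambda>n. LINT x|M. u n x * \<psi> x) \<longlonglongrightarrow> (LINT x|M. v x * \<psi> x)"
proof -
  have int: "integrable M (\<lambda>x. u n x * \<psi> x)" "integrable M (\<lambda>x. v x * \<psi> x)"
    "integrable M (\<lambda>x. (u n x - v x) * \<psi> x)" for n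
    using u v by (auto intro!: integrable_times_bounded[OF _ \<psi>])
  have "norm ((LINT x|M. u n x * \<psi> x) - (LINT x|M. v x * \<psi> x)) \<le> B * (LINT x|M. norm (u n x - v x))" for n
  proof -
    have "(LINT x|M. u n x * \<psi> x) - (LINT x|M. v x * \<psi> x) = (LINT x|M. (u n x - v x) * \<psi> x)"
      using int by (simp add: left_diff_distrib)
    also have "norm \<dots> \<le> (LINT x|M. norm ((u n x - v x) * \<psi> x))"
      by (rule integral_norm_bound)
    also have "\<dots> \<le> (LINT x|M. B * norm (u n x - v x))"
    proof (rule integral_mono)
      show "integrable M (\<lambda>x. norm ((u n x - v x) * \<psi> x))" by (intro integrable_norm int)
      show "norm ((u n x - v x) * \<psi> x) \<le> B * norm (u n x - v x)" for x
        using mult_right_mono[OF \<psi>(2), of "norm (u n x - v x)" x] by (simp add: abs_mult mult.commute)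
    qed (use u v in simp)
    also have "\<dots> = B * (LINT x|M. norm (u n x - v x))" by simp
    finally show ?thesis .
  qed
  then have bound: "\<forall>\<^sub>F n in sequentially. norm ((LINT x|M. u n x * \<psi> x) - (LINT x|M. v x * \<psi> x))
      \<le> B * (LINT x|M. norm (u n x - v x))"
    by (intro always_eventually allI)
  have "(\<lambda>n. B * (LINT x|M. norm (u n x - v x))) \<longlonglongrightarrow> 0"
    using tendsto_mult_left[OF lim, of B] by simp
  from Lim_null_comparison[OF bound this]
  have "(\<lambda>n. (LINT x|M. u n x * \<psi> x) - (LINT x|M. v x * \<psi> x)) \<longlonglongrightarrow> 0"
    .
  then show ?thesis by (simp add: LIM_zero_iff)
qed

text \<open>Both sides of the integration by parts identity are continuous under L1 convergence,
  because a test function and its partial derivatives are bounded. This provides the closedness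
  asked for in \<open>minimizer_exists\<close>.\<close>

lemma is_weak_gradient_limit:
  fixes \<Omega> :: "'a::euclidean_space set"
  assumes \<Omega>: "\<Omega> \<in> sets lebesgue" and wg: "\<And>n. is_weak_gradient \<Omega> (u n) (G n)"
    and int: "\<And>n. integrable (lebesgue_on \<Omega>) (u n)" "\<And>n. integrable (lebesgue_on \<Omega>) (G n)"
      "integrable (lebesgue_on \<Omega>) v" "integrable (lebesgue_on \<Omega>) H"
    and u: "(\<lambda>n. LINT x|lebesgue_on \<Omega>. norm (u n x - v x)) \<longlonglongrightarrow> 0"
    and G: "(\<lambda>n. LINT x|lebesgue_on \<Omega>. norm (G n x - H x)) \<longlonglongrightarrow> 0"
  shows "is_weak_gradient \<Omega> v H"
  unfolding is_weak_gradient_def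
proof (intro conjI allI impI ballI)
  show "locally_integrable \<Omega> v" "locally_integrable \<Omega> H"
    using int \<Omega> by (auto intro: integrable_imp_locally_integrable)
  fix \<psi> i assume \<psi>: "test_function \<Omega> \<psi>" and i: "i \<in> (Basis :: 'a set)"
  let ?M = "lebesgue_on \<Omega>" and ?D = "\<lambda>x. frechet_derivative \<psi> (at x) i"
  note D = test_function_partial[OF \<psi> i]
  obtain B where B: "\<And>x. norm (?D x) \<le> B" using test_function_bounded[OF D] by metis
  obtain B' where B': "\<And>x. norm (\<psi> x) \<le> B'" using test_function_bounded[OF \<psi>] by metis
  have 1: "(\<lambda>n. LINT x|?M. u n x * ?D x) \<longlonglongrightarrow> (LINT x|?M. v x * ?D x)"
    by (rule integral_times_bounded_tendsto[OF int(1,3) u test_function_measurable[OF D \<Omega>] B])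
  have Gi: "(\<lambda>n. LINT x|?M. norm (G n x \<bullet> i - H x \<bullet> i)) \<longlonglongrightarrow> 0"
  proof (rule Lim_null_comparison[OF always_eventually G], intro allI)
    fix n
    have "(LINT x|?M. norm (G n x \<bullet> i - H x \<bullet> i)) \<le> (LINT x|?M. norm (G n x - H x))"
      using int i by (intro integral_mono) (auto simp: inner_diff_left[symmetric] Basis_le_norm)
    then show "norm (LINT x|?M. norm (G n x \<bullet> i - H x \<bullet> i)) \<le> (LINT x|?M. norm (G n x - H x))"
      by simp
  qed
  have 2: "(\<lambda>n. LINT x|?M. (G n x \<bullet> i) * \<psi> x) \<longlonglongrightarrow> (LINT x|?M. (H x \<bullet> i) * \<psi> x)"
    using int by (intro integral_times_bounded_tendsto[OF _ _ Gi test_function_measurable[OF \<psi> \<Omega>] B']) auto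
  have "(\<lambda>n. LINT x|?M. u n x * ?D x) = (\<lambda>n. - (LINT x|?M. (G n x \<bullet> i) * \<psi> x))"
    using wg \<psi> i by (auto simp: is_weak_gradient_def)
  with 1 have "(\<lambda>n. - (LINT x|?M. (G n x \<bullet> i) * \<psi> x)) \<longlonglongrightarrow> (LINT x|?M. v x * ?D x)" by simp
  from LIMSEQ_unique[OF this tendsto_minus[OF 2]]
  show "(LINT x|?M. v x * ?D x) = - (LINT x|?M. (H x \<bullet> i) * \<psi> x)" .
qed

text \<open>The limit concerns one \<open>t\<close> at a time, with an exceptional null set that may
  depend on \<open>t\<close>. A single \<open>T\<close> with essential infimum above
  \<open>1 / \<eta>\<close> suffices: by convexity and \<open>\<phi> x 0 = 0\<close> the quotient
  \<open>\<phi> x t / t\<close> is nondecreasing, so the bound persists for all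
  \<open>t \<ge> T\<close> outside one null set.\<close>

lemma superlinear_bound:
  fixes \<phi> :: "'a \<Rightarrow> real \<Rightarrow> real"
  assumes meas: "\<And>t. t \<ge> 0 \<Longrightarrow> (\<lambda>x. \<phi> x t) \<in> borel_measurable M"
    and convex: "AE x in M. convex_on {0..} (\<phi> x) \<and> \<phi> x 0 = 0"
    and lim: "((\<lambda>t. essinf M (\<lambda>x. ereal (\<phi> x t / t))) \<longlongrightarrow> \<infinity>) at_top"
    and \<eta>: "\<eta> > 0"
  shows "\<exists>T\<ge>0. AE x in M. \<forall>t\<ge>T. t \<le> \<eta> * \<phi> x t"
proof -
  have "eventually (\<lambda>t. ereal (1 / \<eta>) < essinf M (\<lambda>x. ereal (\<phi> x t / t)) \<and> t \<ge> 1) at_top"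
    using lim by (intro eventually_conj eventually_ge_at_top) (auto simp: tendsto_PInfty)
  then obtain T where T: "ereal (1 / \<eta>) < essinf M (\<lambda>x. ereal (\<phi> x T / T))" "T \<ge> 1"
    using eventually_happens'[OF trivial_limit_at_top_linorder] by blast
  have "AE x in M. - ereal (\<phi> x T / T) \<le> esssup M (\<lambda>x. - ereal (\<phi> x T / T))"
    by (rule esssup_AE)
  then have "AE x in M. 1 / \<eta> \<le> \<phi> x T / T"
  proof eventually_elim
    case (elim x)
    have "essinf M (\<lambda>x. ereal (\<phi> x T / T)) \<le> ereal (\<phi> x T / T)"
      using elim unfolding essinf_def by (simp add: ereal_uminus_le_reorder)
    with T(1) have "ereal (1 / \<eta>) \<le> ereal (\<phi> x T / T)" by (rule less_imp_le[OF less_le_trans])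
    then show ?case by simp
  qed
  with convex have "AE x in M. \<forall>t\<ge>T. t \<le> \<eta> * \<phi> x t"
  proof (eventually_elim, intro allI impI)
    fix x t
    assume elim: "convex_on {0..} (\<phi> x) \<and> \<phi> x 0 = 0" "1 / \<eta> \<le> \<phi> x T / T" "T \<le> t"
    have t: "t > 0" using T elim by simp
    have "\<phi> x ((1 - T / t) *\<^sub>R 0 + (T / t) *\<^sub>R t) \<le> (1 - T / t) * \<phi> x 0 + T / t * \<phi> x t"
      using elim t T(2) by (intro convex_onD[of "{0..}"]) auto
    then have "\<phi> x T \<le> T / t * \<phi> x t" using elim t by simp
    moreover have "T \<le> \<eta> * \<phi> x T" using elim T(2) \<eta> by (simp add: field_simps)
    ultimately have "T \<le> \<eta> * (T / t * \<phi> x t)" using \<eta> by (meson mult_left_mono less_imp_le order_trans)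
    then have "T * t \<le> T * (\<eta> * \<phi> x t)" using t by (simp add: field_simps)
    then show "t \<le> \<eta> * \<phi> x t" using T(2) by simp
  qed
  then show ?thesis using T(2) by (intro exI[of _ T]) auto
qed

section \<open>Transfer to weak gradients on the bounded domain\<close>

theorem proposition3p3:
  fixes \<Omega> :: "(real ^ 'n) set"
    and f :: "real ^ 'n \<Rightarrow> real"
    and \<phi> :: "real ^ 'n \<Rightarrow> real \<Rightarrow> real"
  assumes domain: "bounded_lipschitz_domain \<Omega>"
    and f: "f \<in> L2_fun \<Omega>"
    and nonneg: "\<And>x t. x \<in> \<Omega> \<Longrightarrow> t \<ge> 0 \<Longrightarrow> \<phi> x t \<ge> 0"
    and measurable: "\<And>t. t \<ge> 0 \<Longrightarrow> (\<lambda>x. \<phi> x t) \<in> borel_measurable (lebesgue_on \<Omega>)"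
    and convex: "AE x in lebesgue_on \<Omega>. convex_on {0..} (\<phi> x) \<and> mono_on {0..} (\<phi> x) \<and>
                   continuous_on {0..} (\<phi> x) \<and> \<phi> x 0 = 0"
    and L1: "\<And>t. t \<ge> 0 \<Longrightarrow> integrable (lebesgue_on \<Omega>) (\<lambda>x. \<phi> x t)"
    and doubling: "\<exists>C. AE x in lebesgue_on \<Omega>. \<forall>t \<ge> 0. \<phi> x (2 * t) \<le> C * \<phi> x t"
    and superlinear:
      "((\<lambda>t. essinf (lebesgue_on \<Omega>) (\<lambda>x. ereal (\<phi> x t / t))) \<longlongrightarrow> \<infinity>) at_top"
  shows "\<exists>u \<in> X_space \<Omega> \<phi>.
           (\<forall>w \<in> X_space \<Omega> \<phi>. functional_F \<Omega> \<phi> f u \<le> functional_F \<Omega> \<phi> f w) \<and>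
           (\<forall>v \<in> X_space \<Omega> \<phi>.
              (\<forall>w \<in> X_space \<Omega> \<phi>. functional_F \<Omega> \<phi> f v \<le> functional_F \<Omega> \<phi> f w) \<longrightarrow>
              (AE x in lebesgue_on \<Omega>. v x = u x))"
proof -
  have \<Omega>: "open \<Omega>" "bounded \<Omega>" using domain by (auto simp: bounded_lipschitz_domain_def)
  then have \<Omega>_lm: "\<Omega> \<in> lmeasurable" by (intro lmeasurable_open)
  then have \<Omega>_sets: "\<Omega> \<in> sets lebesgue" by (rule fmeasurableD)
  have carath: "(\<lambda>x. \<phi> x (h x)) \<in> borel_measurable (lebesgue_on \<Omega>)"
    if "h \<in> borel_measurable (lebesgue_on \<Omega>)" "\<And>x. h x \<ge> 0" for h
    using convex by (intro caratheodory_measurable[OF \<Omega>_sets measurable _ that]) (auto elim: eventually_mono)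
  interpret finite_measure "lebesgue_on \<Omega>"
    using \<Omega>_lm by (rule finite_measure_lebesgue_on)
  interpret superlinear_energy "lebesgue_on \<Omega>" \<phi> f
  proof
    show "\<exists>T\<ge>0. AE x in lebesgue_on \<Omega>. \<forall>t\<ge>T. t \<le> \<eta> * \<phi> x t" if "\<eta> > 0" for \<eta>
      using convex by (intro superlinear_bound[OF measurable _ superlinear that]) (auto elim: eventually_mono)
    show "AE x in lebesgue_on \<Omega>. convex_on {0..} (\<phi> x) \<and> mono_on {0..} (\<phi> x) \<and> continuous_on {0..} (\<phi> x)"
      using convex by (auto elim: eventually_mono)
  qed (use nonneg carath f in \<open>auto simp: L2_fun_def\<close>)

  \<comment> \<open>A relation in place of the map \<open>weak_gradient\<close>: the weak gradients
    of midpoints and limits are then the constructed fields themselves, with no choice to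
    reconcile.\<close>
  define P :: "((real ^ 'n \<Rightarrow> real) \<times> (real ^ 'n \<Rightarrow> real ^ 'n)) set"
    where "P = {(u, G). is_weak_gradient \<Omega> u G \<and> finite_energy u G}"
  have modular_eq: "modular \<Omega> \<phi> (weak_gradient \<Omega> u) = (\<integral>\<^sup>+x. \<phi> x (norm (G x)) \<partial>lebesgue_on \<Omega>)"
    if "is_weak_gradient \<Omega> u G" for u G
  proof -
    have "is_weak_gradient \<Omega> u (weak_gradient \<Omega> u)"
      unfolding weak_gradient_def by (rule someI[of "is_weak_gradient \<Omega> u", OF that])
    from weak_gradient_unique[OF \<Omega>(1) this that] show ?thesis
      unfolding modular_def by (intro nn_integral_cong_AE) (auto elim: eventually_mono)
  qed
  have X: "u \<in> X_space \<Omega> \<phi>" and F: "functional_F \<Omega> \<phi> f u = energy u G" if "(u, G) \<in> P" for u G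
  proof -
    have wg: "is_weak_gradient \<Omega> u G" and fe: "finite_energy u G" using that by (auto simp: P_def)
    note int = finite_energyD[OF fe]
    have mod: "modular \<Omega> \<phi> (weak_gradient \<Omega> u) = ennreal (LINT x|lebesgue_on \<Omega>. \<phi> x (norm (G x)))"
      unfolding modular_eq[OF wg] using int nonneg by (intro nn_integral_eq_integral) auto
    show "u \<in> X_space \<Omega> \<phi>"
      using int wg mod by (auto simp: X_space_def L2_fun_def W11_fun_def)
    show "functional_F \<Omega> \<phi> f u = energy u G"
      using energy_ge(1)[OF fe] by (simp add: functional_F_def mod energy_def L2_norm_def)
  qed
  have X_P: "\<exists>G. (u, G) \<in> P" if uX: "u \<in> X_space \<Omega> \<phi>" for u
  proof -
    obtain G where wg: "is_weak_gradient \<Omega> u G" and G: "integrable (lebesgue_on \<Omega>) G"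
      using uX by (auto simp: X_space_def W11_fun_def)
    have "(\<integral>\<^sup>+x. \<phi> x (norm (G x)) \<partial>lebesgue_on \<Omega>) < \<infinity>"
      using uX by (simp add: X_space_def modular_eq[OF wg])
    then have "integrable (lebesgue_on \<Omega>) (\<lambda>x. \<phi> x (norm (G x)))"
      using G nonneg by (intro integrableI_nonneg carath) auto
    with uX wg G have "(u, G) \<in> P"
      by (auto simp: P_def finite_energy_def X_space_def L2_fun_def)
    then show ?thesis by blast
  qed
  have P_mid: "(mid u v, mid G H) \<in> P" if "(u, G) \<in> P" "(v, H) \<in> P" for u G v H
    using is_weak_gradient_midpoint[OF \<Omega>_sets, of u G v H] finite_energy_mid(1)[of u G v H] that
    by (simp add: P_def mid_def[abs_def])
  have "\<exists>u G. (u, G) \<in> P \<and> (\<forall>v H. (v, H) \<in> P \<longrightarrow> energy u G \<le> energy v H)"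
  proof (rule minimizer_exists)
    \<comment> \<open>The zero pair is admissible; integrability of \<open>\<phi>\<close> at 0 comes
      from \<open>L1\<close>.\<close>
    have "is_weak_gradient \<Omega> (\<lambda>x. 0) (\<lambda>x. 0)"
      by (simp add: is_weak_gradient_def locally_integrable_def)
    moreover have "finite_energy (\<lambda>x. 0) (\<lambda>x. 0)"
      using L1[of 0] by (simp add: finite_energy_def)
    ultimately show "P \<noteq> {}" by (auto simp: P_def)
  next
    fix u :: "nat \<Rightarrow> real ^ 'n \<Rightarrow> real" and G v H
    assume *: "\<And>n. (u n, G n) \<in> P" "finite_energy v H"
      "(\<lambda>n. LINT x|lebesgue_on \<Omega>. norm (u n x - v x)) \<longlonglongrightarrow> 0"
      "(\<lambda>n. LINT x|lebesgue_on \<Omega>. norm (G n x - H x)) \<longlonglongrightarrow> 0"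
    then have wg: "is_weak_gradient \<Omega> (u n) (G n)" and fe: "finite_energy (u n) (G n)" for n
      by (auto simp: P_def)
    have "is_weak_gradient \<Omega> v H"
      by (rule is_weak_gradient_limit[OF \<Omega>_sets wg finite_energyD(6,3)[OF fe]
            finite_energyD(6,3)[OF *(2)] *(3,4)])
    with *(2) show "(v, H) \<in> P" by (simp add: P_def)
  qed (use P_mid in \<open>auto simp: P_def\<close>)
  then obtain u G where uG: "(u, G) \<in> P" and min: "\<And>v H. (v, H) \<in> P \<Longrightarrow> energy u G \<le> energy v H"
    by blast
  show ?thesis
  proof (intro bexI[of _ u] conjI ballI impI)
    show "u \<in> X_space \<Omega> \<phi>" by (rule X[OF uG])
    fix w assume "w \<in> X_space \<Omega> \<phi>"
    then obtain K where "(w, K) \<in> P" using X_P by blast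
    with min uG show "functional_F \<Omega> \<phi> f u \<le> functional_F \<Omega> \<phi> f w" by (simp add: F)
  next
    fix v assume v: "v \<in> X_space \<Omega> \<phi>"
      and v_min: "\<forall>w\<in>X_space \<Omega> \<phi>. functional_F \<Omega> \<phi> f v \<le> functional_F \<Omega> \<phi> f w"
    obtain H where vH: "(v, H) \<in> P" using X_P[OF v] by blast
    note m = P_mid[OF uG vH]
    have "energy v H \<le> energy (mid u v) (mid G H)"
      using v_min X[OF m] by (auto simp: F[OF vH] F[OF m])
    then show "AE x in lebesgue_on \<Omega>. v x = u x"
      using uG vH min[OF m] by (intro minimizer_unique[of u G v H]) (auto simp: P_def)
  qed
qed

end
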